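(* For every even integer $n\geq 6$, the tight lower bound $low(n)$ on the dimensions of the maximal faces of the cone $\mathbb{CP}(n)$ of completely positive $n\times n$ matrices satisfies $$n\leq low(n)\leq n+3.$$
   Context: $\mathbb{S}(n)$ denotes the space of real symmetric $n\times n$ matrices. The cone of completely positive matrices is $\mathbb{CP}(n):=\mathrm{cone}\{\mathbf{x}\mathbf{x}^\top:\ \mathbf{x}\in\mathbb{R}^n_+\}\subset\mathbb{S}(n)$, the set of all finite conic (nonnegative linear) combinations of matrices $\mathbf{x}\mathbf{x}^\top$ with $\mathbf{x}$ in the nonnegative orthant $\mathbb{R}^n_+$. A nonempty convex subset $\mathcal{F}$ of a convex cone $\mathcal{K}$ is a face of $\mathcal{K}$ if $\alpha x+(1-\alpha)y\in\mathcal{F}$ with $x,y\in\mathcal{K}$ and $\alpha\in(0,1)$ implies $x,y\in\mathcal{F}$. A face $\mathcal{F}$ is a maximal face of $\mathcal{K}$ if $\mathcal{F}\neq\mathcal{K}$ and there is no other face $\bar{\mathcal{F}}\neq\mathcal{K}$ of $\mathcal{K}$ with $\mathcal{F}\subset\bar{\mathcal{F}}$. The dimension of a face is the dimension of its affine hull. $low(n):=\min\{\dim(\mathcal{F}):\ \mathcal{F}\text{ is a maximal face of }\mathbb{CP}(n)\}$. *)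

theory Defs
  imports "HOL-Analysis.Analysis"
begin

definition outer :: "real ^ 'n \<Rightarrow> real ^ 'n ^ 'n" where
  "outer x = (columnvector x :: real ^ 1 ^ 'n) ** (rowvector x :: real ^ 'n ^ 1)"

lemma outer_nth: "outer x $ i $ j = x $ i * x $ j"
  by (simp add: outer_def matrix_matrix_mult_def columnvector_def rowvector_def)

definition completely_positive :: "(real ^ 'n ^ 'n) set" where
  "completely_positive = convex_cone hull {outer x |x. \<forall>i. 0 \<le> x $ i}"

lemma completely_positive_conic_combinations:
  "(completely_positive :: (real ^ 'n ^ 'n) set) =
    {\<Sum>k<m. c k *\<^sub>R outer (x k) |(m::nat) c x. \<forall>k<m. 0 \<le> c k \<and> (\<forall>i. 0 \<le> x k $ i)}"
  (is "_ = ?C")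
proof
  let ?S = "{outer x |x :: real ^ 'n. \<forall>i. 0 \<le> x $ i}"
  have 0: "0 \<in> ?C"
    by (intro CollectI exI[of _ 0]) simp
  have add: "a + b \<in> ?C" if ab: "a \<in> ?C" "b \<in> ?C" for a b
  proof -
    obtain m :: nat and c x where a: "a = (\<Sum>k<m. c k *\<^sub>R outer (x k))"
      "\<forall>k<m. 0 \<le> c k \<and> (\<forall>i. 0 \<le> x k $ i)" using ab by blast
    obtain m' :: nat and c' x' where b: "b = (\<Sum>k<m'. c' k *\<^sub>R outer (x' k))"
      "\<forall>k<m'. 0 \<le> c' k \<and> (\<forall>i. 0 \<le> x' k $ i)" using ab by blast
    define d where "d k = (if k < m then c k else c' (k - m))" for k
    define y where "y k = (if k < m then x k else x' (k - m))" for k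
    have "(\<Sum>k<m+m'. d k *\<^sub>R outer (y k)) = 
        (\<Sum>k<m. d k *\<^sub>R outer (y k)) + (\<Sum>k<m'. d (m + k) *\<^sub>R outer (y (m + k)))"
      by (induction m') (simp_all add: add.assoc)
    also have "\<dots> = a + b"
      by (simp add: a b d_def y_def)
    finally have "a + b = (\<Sum>k<m+m'. d k *\<^sub>R outer (y k))" ..
    moreover have "\<forall>k<m+m'. 0 \<le> d k \<and> (\<forall>i. 0 \<le> y k $ i)"
      using a(2) b(2) by (auto simp: d_def y_def)
    ultimately show ?thesis by blast
  qed
  have scale: "r *\<^sub>R a \<in> ?C" if ar: "a \<in> ?C" "0 \<le> r" for a r
  proof -
    obtain m :: nat and c x where a: "a = (\<Sum>k<m. c k *\<^sub>R outer (x k))"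
      "\<forall>k<m. 0 \<le> c k \<and> (\<forall>i. 0 \<le> x k $ i)" using ar by blast
    have "r *\<^sub>R a = (\<Sum>k<m. (r * c k) *\<^sub>R outer (x k))"
      by (simp add: a scaleR_sum_right)
    moreover have "\<forall>k<m. 0 \<le> r * c k \<and> (\<forall>i. 0 \<le> x k $ i)"
      using a(2) ar(2) by simp
    ultimately show ?thesis
      by (intro CollectI exI[of _ m] exI[of _ "\<lambda>k. r * c k"] exI[of _ x]) simp
  qed
  have "convex_cone ?C"
    unfolding convex_cone_iff by (intro conjI ballI allI impI 0 add scale)
  moreover have "?S \<subseteq> ?C"
  proof
    fix a assume "a \<in> ?S"
    then obtain x :: "real ^ 'n" where "a = outer x" "\<forall>i. 0 \<le> x $ i" by blast
    then show "a \<in> ?C"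
      by (intro CollectI exI[of _ "1::nat"] exI[of _ "\<lambda>_. 1::real"] exI[of _ "\<lambda>_. x"]) simp
  qed
  ultimately show "completely_positive \<subseteq> ?C"
    unfolding completely_positive_def by (rule hull_minimal[rotated])
  show "?C \<subseteq> completely_positive"
  proof
    fix a assume "a \<in> ?C"
    then obtain m :: nat and c x where a: "a = (\<Sum>k<m. c k *\<^sub>R outer (x k))"
      "\<forall>k<m. 0 \<le> c k \<and> (\<forall>i. 0 \<le> x k $ i)" by blast
    have "(\<Sum>k<l. c k *\<^sub>R outer (x k)) \<in> convex_cone hull ?S" if "l \<le> m" for l
      using that
    proof (induction l)
      case 0
      show ?case by (simp add: convex_cone_hull_contains_0)
    next
      case (Suc l)
      have "outer (x l) \<in> convex_cone hull ?S"
        using a(2) Suc.prems by (intro hull_inc) auto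
      with Suc a(2) show ?case
        by (simp add: convex_cone_hull_add convex_cone_hull_mul)
    qed
    then show "a \<in> completely_positive"
      by (simp add: a completely_positive_def)
  qed
qed

text \<open>The library relation \<open>face_of\<close> admits the empty set, which is not a face here.\<close>

definition maximal_face :: "'a::real_vector set \<Rightarrow> 'a set \<Rightarrow> bool" where
  "maximal_face K F \<longleftrightarrow>
    F face_of K \<and> F \<noteq> {} \<and> F \<noteq> K \<and>
    \<not> (\<exists>G. G face_of K \<and> G \<noteq> {} \<and> G \<noteq> K \<and> F \<subset> G)"

lemma finite_aff_dims: "finite {aff_dim F |F :: 'a::euclidean_space set. P F}"
proof (rule finite_subset)
  show "{aff_dim F |F :: 'a set. P F} \<subseteq> {-1..int DIM('a)}"
    by (auto simp: aff_dim_geq aff_dim_le_DIM)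
qed simp

text \<open>
  The order \<open>n\<close> of the matrices is \<open>CARD('n)\<close>. The minimum is over a finite set of integers
  by \<open>finite_aff_dims\<close>.
\<close>

definition low :: "'n::finite itself \<Rightarrow> int" where
  "low _ = Min {aff_dim F |F. maximal_face (completely_positive :: (real ^ 'n ^ 'n) set) F}"

end

(*
  Lower bound.  If the generators of a maximal face F do not span R^n, some v /= 0 is orthogonal to all
  of them, so F lies in, hence equals, the face of all X with v^T X v = 0; its generators span the hyperplane orthogonal to v
  (or, when v has constant sign, v may be replaced by a unit vector).  In either case a basis
  b1, b2, ... of generators, completed in the second case by b1 + b2, yields n independent
  matrices x x^T.

  Upper bound.  Put m = n - 1, an odd number.  On m-periodic sequences X consider the circulant form
  f(X) = sum (QX)^2 + t (sum X)^2 - e sum X^2, where Q is the third-order difference operator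
  with kernel spanned by 1, cos(2 pi i/m), sin(2 pi i/m), the number t > 0 is small, and e is the
  minimum that makes f positive semidefinite and singular on the window X(-1) = X(0) = 0.  For small
  t, compactness forces the null vector U of the window to be close to the positive solution
  sin(pi i/m) sin(pi (i+1)/m) of QX = 0, and f to be positive on nonnegative sequences with two
  nonadjacent zeros.  Since f(U, Y) = c (Y(-1) + Y(0)) with c > 0, subtracting shifts of U from a
  nonnegative sequence decreases f and reduces the support: f is copositive and its zeros are exactly
  the m rays of the shifts of U.  These shifts determine f up to a factor, because m is odd and
  U(2) > U(1).

  For the order n, replace x by its first m coordinates plus x_n W, where W >= 0 vanishes exactly at
  four consecutive positions.  Only three shifts of U dominate a multiple of W, so the zeros of the new
  form span only m + 1 + 3 = n + 3 dimensions of matrices x x^T, and they still determine the form.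
*)
theory Submission
  imports Defs
begin

section \<open>Periodic sequences and circulant forms\<close>

text \<open>Sequences on the cycle Z/m are encoded as functions on all integers, so that shifts and
  reflections are plain substitutions of the index.\<close>

definition per :: "int \<Rightarrow> (int \<Rightarrow> real) \<Rightarrow> bool" where
  "per m X \<longleftrightarrow> (\<forall>i. X (i + m) = X i)"

lemma per_mod:
  assumes "per m X" shows "X (i mod m) = X i"
proof -
  have n: "X (j + int k * m) = X j" for j k
  proof (induction k)
    case (Suc k)
    have "j + int (Suc k) * m = (j + int k * m) + m" by (simp add: algebra_simps)
    then show ?case using assms Suc unfolding per_def by metis
  qed simp
  have "X (j + k * m) = X j" for j k
  proof (cases "k \<ge> 0")
    case True then show ?thesis using n[of j "nat k"] by simp
  next
    case False then show ?thesis using n[of "j + k * m" "nat (-k)"] by simp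
  qed
  from this[of "i mod m" "i div m"] show ?thesis by simp
qed

lemma per_cong:
  assumes "per m X" "i mod m = j mod m" shows "X i = X j"
  using per_mod[OF assms(1)] assms(2) by metis

lemma per_shift: "per m X \<Longrightarrow> per m (\<lambda>i. X (i + k))"
  unfolding per_def by (metis add.assoc add.commute)

lemma per_shift': "per m X \<Longrightarrow> per m (\<lambda>i. X (i - k))"
  using per_shift[of m X "-k"] by simp

lemma per_reflect: "per m X \<Longrightarrow> per m (\<lambda>i. X (k - i))"
  unfolding per_def
proof (intro allI)
  fix i assume "\<forall>i. X (i + m) = X i"
  from this[rule_format, of "k - (i + m)"] show "X (k - (i + m)) = X (k - i)" by simp
qed

lemma sum_per_shift:
  assumes "per m F" "m > 0"
  shows "(\<Sum>i\<in>{0..<m}. F (i + k)) = (\<Sum>i\<in>{0..<m}. F i)"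
proof (rule sum.reindex_bij_witness[where i = "\<lambda>i. (i - k) mod m" and j = "\<lambda>i. (i + k) mod m"])
  fix a assume "a \<in> {0..<m}"
  then show "((a + k) mod m - k) mod m = a" "((a - k) mod m + k) mod m = a"
    by (simp_all add: mod_simps)
  show "F ((a + k) mod m) = F (a + k)" using per_mod[OF assms(1)] .
qed (use assms in auto)

lemma sum_per_reflect:
  assumes "per m F" "m > 0"
  shows "(\<Sum>i\<in>{0..<m}. F (k - i)) = (\<Sum>i\<in>{0..<m}. F i)"
proof (rule sum.reindex_bij_witness[where i = "\<lambda>i. (k - i) mod m" and j = "\<lambda>i. (k - i) mod m"])
  fix a assume "a \<in> {0..<m}"
  then show "(k - (k - a) mod m) mod m = a" "(k - (k - a) mod m) mod m = a"
    by (simp_all add: mod_simps)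
  show "F ((k - a) mod m) = F (k - a)" using per_mod[OF assms(1)] .
qed (use assms in auto)

text \<open>The characteristic polynomial is \<open>(x - 1) (x\<^sup>2 - 2 cos (2 \<pi> / m) x + 1)\<close>.\<close>

definition third_diff :: "int \<Rightarrow> (int \<Rightarrow> real) \<Rightarrow> int \<Rightarrow> real" where
  "third_diff m X i = X (i + 3) - (1 + 2 * cos (2 * pi / m)) * X (i + 2)
     + (1 + 2 * cos (2 * pi / m)) * X (i + 1) - X i"

text \<open>The polarisation of the quadratic form f: a null vector will be paired with arbitrary
  sequences.\<close>

definition circ_form :: "int \<Rightarrow> real \<Rightarrow> real \<Rightarrow> (int \<Rightarrow> real) \<Rightarrow> (int \<Rightarrow> real) \<Rightarrow> real" where
  "circ_form m t e X Y = (\<Sum>i\<in>{0..<m}. third_diff m X i * third_diff m Y i)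
     + t * ((\<Sum>i\<in>{0..<m}. X i) * (\<Sum>i\<in>{0..<m}. Y i)) - e * (\<Sum>i\<in>{0..<m}. X i * Y i)"

lemma third_diff_add: "third_diff m (\<lambda>i. X i + Y i) i = third_diff m X i + third_diff m Y i"
  and third_diff_scale: "third_diff m (\<lambda>i. c * X i) i = c * third_diff m X i"
  by (simp_all add: third_diff_def algebra_simps)

lemma circ_form_commute: "circ_form m t e X Y = circ_form m t e Y X"
  by (simp add: circ_form_def mult.commute)

lemma circ_form_add_right: "circ_form m t e X (\<lambda>i. Y i + Z i) = circ_form m t e X Y + circ_form m t e X Z"
  by (simp add: circ_form_def third_diff_add algebra_simps sum.distrib)

lemma circ_form_scale_right: "circ_form m t e X (\<lambda>i. c * Y i) = c * circ_form m t e X Y"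
  by (simp add: circ_form_def third_diff_scale algebra_simps sum_distrib_left)

lemma circ_form_add_left: "circ_form m t e (\<lambda>i. X i + Y i) Z = circ_form m t e X Z + circ_form m t e Y Z"
  by (metis circ_form_add_right circ_form_commute)

lemma circ_form_scale_left: "circ_form m t e (\<lambda>i. c * X i) Y = c * circ_form m t e X Y"
  by (metis circ_form_scale_right circ_form_commute)

text \<open>Applied when \<open>Y\<close> is a null vector, so that the last summand drops
  out.\<close>

lemma circ_form_quad_add:
  "circ_form m t e (\<lambda>i. X i + c * Y i) (\<lambda>i. X i + c * Y i) =
    circ_form m t e X X + 2 * c * circ_form m t e Y X + c\<^sup>2 * circ_form m t e Y Y"
  using circ_form_commute[of m t e X Y]
  by (simp add: circ_form_add_left circ_form_add_right circ_form_scale_left circ_form_scale_right power2_eq_square algebra_simps)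

lemma per_third_diff: "per m X \<Longrightarrow> per m (third_diff m X)"
  unfolding per_def third_diff_def
proof (intro allI)
  fix i assume X: "\<forall>i. X (i + m) = X i"
  have "X (i + m + k) = X (i + k)" for k
    using X[rule_format, of "i + k"] by (simp add: ac_simps)
  with X show "X (i + m + 3) - (1 + 2 * cos (2 * pi / m)) * X (i + m + 2)
      + (1 + 2 * cos (2 * pi / m)) * X (i + m + 1) - X (i + m) =
    X (i + 3) - (1 + 2 * cos (2 * pi / m)) * X (i + 2)
      + (1 + 2 * cos (2 * pi / m)) * X (i + 1) - X i" by simp
qed

lemma circ_form_shift:
  assumes "per m X" "per m Y" "m > 0"
  shows "circ_form m t e (\<lambda>i. X (i + k)) (\<lambda>i. Y (i + k)) = circ_form m t e X Y"
proof -
  have Q: "third_diff m (\<lambda>i. Z (i + k)) i = third_diff m Z (i + k)" for Z i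
    by (simp add: third_diff_def algebra_simps)
  have "per m (\<lambda>i. third_diff m X i * third_diff m Y i)" "per m (\<lambda>i. X i * Y i)"
    using per_third_diff assms by (simp_all add: per_def)
  from this[THEN sum_per_shift, OF assms(3), of k]
  show ?thesis using sum_per_shift[OF assms(1,3), of k] sum_per_shift[OF assms(2,3), of k]
    by (simp add: circ_form_def Q)
qed

text \<open>The coefficients of the difference operator are antisymmetric under reversal, so a
  reflection only moves the index and flips the sign of \<open>third_diff\<close>; the sign cancels
  in the product.\<close>

lemma circ_form_reflect:
  assumes "per m X" "per m Y" "m > 0"
  shows "circ_form m t e (\<lambda>i. X (k - i)) (\<lambda>i. Y (k - i)) = circ_form m t e X Y"
proof -
  have Q: "third_diff m (\<lambda>i. Z (k - i)) i = - third_diff m Z (k - 3 - i)" for Z i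
    by (simp add: third_diff_def algebra_simps)
  have "per m (\<lambda>i. third_diff m X i * third_diff m Y i)" "per m (\<lambda>i. X i * Y i)"
    using per_third_diff assms by (simp_all add: per_def)
  then show ?thesis
    using sum_per_reflect[OF assms(1,3), of k] sum_per_reflect[OF assms(2,3), of k]
      sum_per_reflect[of m "\<lambda>i. third_diff m X i * third_diff m Y i" "k - 3"]
      sum_per_reflect[of m "\<lambda>i. X i * Y i" k] assms(3)
    by (simp add: circ_form_def Q)
qed

section \<open>The nonnegative kernel vector of the third-order difference operator\<close>

definition window_vec :: "int \<Rightarrow> int \<Rightarrow> real" where
  "window_vec m i = sin (pi * i / m) * sin (pi * (i + 1) / m)"

lemma per_window_vec: assumes "m > 0" shows "per m (window_vec m)"
proof -
  have "sin (pi * (j + m) / m) = - sin (pi * j / m)" for j :: int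
  proof -
    have "pi * real_of_int (j + m) / m = pi * j / m + pi" using assms by (simp add: field_simps)
    then show ?thesis by simp
  qed
  note h = this
  show ?thesis unfolding per_def
  proof
    fix i show "window_vec m (i + m) = window_vec m i"
      using h[of i] h[of "i + 1"] by (simp add: window_vec_def ac_simps)
  qed
qed

lemma window_vec_pos:
  assumes "1 \<le> i" "i \<le> m - 2" shows "window_vec m i > 0"
proof -
  have "sin (pi * j / m) > 0" if "1 \<le> j" "j \<le> m - 1" for j :: int
    using that by (intro sin_gt_zero) (auto simp: field_simps)
  from this[of i] this[of "i + 1"] assms show ?thesis by (simp add: window_vec_def)
qed

lemma window_vec_zero: "window_vec m (-1) = 0" "window_vec m 0 = 0"
  by (simp_all add: window_vec_def)

lemma window_vec_m1: "m > 0 \<Longrightarrow> window_vec m (-2) = window_vec m 1"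
  by (simp add: window_vec_def)

text \<open>With a = pi/m both values share the factor sin (2a), and sin (3a) - sin a = 2 sin a cos
  (2a) is positive. The strict inequality later makes a recurrence rigid.\<close>

lemma window_vec_12:
  assumes "m \<ge> 5" shows "window_vec m 1 < window_vec m 2"
proof -
  define a where "a = pi / m"
  have a: "0 < a" "5 * a \<le> pi" using assms by (auto simp: a_def field_simps)
  have "sin (2 * a) > 0" using a by (intro sin_gt_zero) auto
  moreover have "sin a < sin (3 * a)"
  proof -
    have "sin (3 * a) - sin a = 2 * sin a * cos (2 * a)"
      using sin_diff_sin[of "3*a" a] by simp
    moreover have "sin a > 0" using a by (intro sin_gt_zero) auto
    moreover have "cos (2 * a) > 0" using a by (intro cos_gt_zero) auto
    ultimately show ?thesis by (smt (verit) mult_pos_pos)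
  qed
  ultimately show ?thesis
    by (simp add: window_vec_def a_def mult.commute)
qed

text \<open>With h = pi/m the product formula turns \<open>window_vec m i\<close> into (cos h - cos
  ((2i+1) h)) / 2. Centred at \<open>B\<close>, the four terms pair up into multiples of sin (3h)
  and (1 + 2 cos (2h)) sin h, which coincide.\<close>

lemma third_diff_window_vec: "third_diff m (window_vec m) i = 0"
proof -
  define h where "h = pi / m"
  define B where "B = (2 * i + 4) * h"
  have v: "window_vec m (i + k) = (cos h - cos (B + (2 * k - 3) * h)) / 2" for k :: int
    unfolding window_vec_def B_def h_def using sin_times_sin[of "pi * (i+k) / m" "pi * (i+k+1) / m"]
    cos_minus[of h]
    by (simp add: algebra_simps add_divide_distrib diff_divide_distrib h_def)
  have s3: "sin (3 * h) = (1 + 2 * cos (2 * h)) * sin h"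
  proof -
    have "sin (2 * h + h) = sin (2 * h) * cos h + cos (2 * h) * sin h" by (rule sin_add)
    also have "\<dots> = (1 + 2 * cos (2 * h)) * sin h"
      using sin_cos_squared_add[of h] unfolding sin_double cos_double by algebra
    finally show ?thesis by simp
  qed
  have c: "cos (B - y) - cos (B + y) = 2 * sin B * sin y" for y
    by (simp add: cos_add cos_diff)
  have "third_diff m (window_vec m) i = ((cos (B - 3 * h) - cos (B + 3 * h))
      - (1 + 2 * cos (2 * h)) * (cos (B - h) - cos (B + h))) / 2"
  proof -
    have k: "2 * pi / m = 2 * h" by (simp add: h_def)
    have v': "window_vec m i = (cos h - cos (B - 3 * h)) / 2" "window_vec m (i + 1) = (cos h - cos (B - h)) / 2"
      "window_vec m (i + 2) = (cos h - cos (B + h)) / 2" "window_vec m (i + 3) = (cos h - cos (B + 3 * h)) / 2"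
      using v[of 0] v[of 1] v[of 2] v[of 3] by simp_all
    have "(H - s) / 2 - K * ((H - r) / 2) + K * ((H - q) / 2) - (H - p) / 2
        = ((p - s) - K * (q - r)) / 2" for H K p q r s :: real
      by (simp add: field_simps)
    then show ?thesis unfolding third_diff_def k v' .
  qed
  also have "\<dots> = 0" by (simp add: c s3)
  finally show ?thesis .
qed

text \<open>The equation is a recurrence of order three, so three consecutive zeros propagate
  forward; periodicity covers the remaining indices.\<close>

lemma third_diff_zero_unique:
  assumes "per m X" "m > 0" "\<And>i. third_diff m X i = 0" "X (-1) = 0" "X 0 = 0" "X 1 = 0"
  shows "X i = 0"
proof -
  have "X (int k - 1) = 0 \<and> X (int k) = 0 \<and> X (int k + 1) = 0" for k
  proof (induction k)
    case (Suc k)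
    then show ?case using assms(3)[of "int k - 1"] by (simp add: third_diff_def algebra_simps)
  qed (use assms in auto)
  from this[of "nat (i mod m)"] have "X (i mod m) = 0" using assms(2) by simp
  then show ?thesis using per_mod[OF assms(1)] by simp
qed

text \<open>Subtracting the multiple of the kernel vector that agrees with \<open>X\<close> at 1
  leaves three consecutive zeros.\<close>

lemma third_diff_zero_window:
  assumes "per m X" "m \<ge> 5" "\<And>i. third_diff m X i = 0" "X (-1) = 0" "X 0 = 0"
  shows "X i = X 1 / window_vec m 1 * window_vec m i"
proof -
  let ?c = "X 1 / window_vec m 1"
  have v1: "window_vec m 1 > 0" using window_vec_pos assms by simp
  have "X i + (- ?c) * window_vec m i = 0"
  proof (rule third_diff_zero_unique[where m = m and X = "\<lambda>i. X i + (- ?c) * window_vec m i"])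
    show "per m (\<lambda>i. X i + (- ?c) * window_vec m i)"
      using assms(1,2) per_window_vec[of m] by (simp add: per_def)
    show "third_diff m (\<lambda>i. X i + (- ?c) * window_vec m i) i = 0" for i
      using assms(3) by (simp only: third_diff_add third_diff_scale third_diff_window_vec)
  qed (use assms v1 window_vec_zero in auto)
  then show ?thesis by simp
qed

text \<open>A kernel element with a zero at 0 is a combination of \<open>window_vec\<close> and its
  shift by one. The coefficients have the signs of \<open>X 1\<close> and \<open>X (-1)\<close>,
  hence are nonnegative, and both vectors are positive at \<open>b\<close>.\<close>

lemma third_diff_zero_nonadjacent:
  assumes "per m X" "m \<ge> 5" "\<And>i. third_diff m X i = 0" "\<And>i. 0 \<le> X i" "X 0 = 0"
    "2 \<le> b" "b \<le> m - 2" "X b = 0"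
  shows "X i = 0"
proof -
  let ?V = "window_vec m"
  let ?s = "X 1 / ?V 1" and ?t = "X (-1) / ?V 1"
  have v1: "?V 1 > 0" using window_vec_pos assms by simp
  have "X i + (- ?s) * ?V i + (- ?t) * ?V (i - 1) = 0" for i
  proof (rule third_diff_zero_unique[where m = m and X = "\<lambda>i. X i + (- ?s) * ?V i + (- ?t) * ?V (i - 1)"])
    show "per m (\<lambda>i. X i + (- ?s) * ?V i + (- ?t) * ?V (i - 1))"
      using assms(1,2) per_window_vec[of m] per_shift'[of m ?V 1] by (simp add: per_def)
    have "third_diff m (\<lambda>i. ?V (i - 1)) i = third_diff m ?V (i - 1)" for i
      by (simp add: third_diff_def algebra_simps)
    then show "third_diff m (\<lambda>i. X i + (- ?s) * ?V i + (- ?t) * ?V (i - 1)) i = 0" for i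
      using assms(3) by (simp only: third_diff_add third_diff_scale third_diff_window_vec)
  qed (use assms v1 window_vec_zero[of m] window_vec_m1[of m] in auto)
  then have X: "X i = ?s * ?V i + ?t * ?V (i - 1)" for i
    by (smt (verit) mult_minus_left)
  have "?s \<ge> 0" "?t \<ge> 0" using assms v1 by auto
  moreover have "?V b > 0" "?V (b - 1) > 0" using window_vec_pos assms by auto
  ultimately have "?s = 0" "?t = 0" using X[of b] assms(8)
    by (smt (verit, best) mult_nonneg_nonneg mult_pos_pos)+
  then show ?thesis using X[of i] by (simp del: divide_eq_0_iff)
qed

section \<open>A circulant form with prescribed zeros\<close>

text \<open>All coordinates but \<open>z\<close> are arranged in a cycle of length \<open>m\<close>;
  \<open>p\<close> is defined on all integers so that they form a periodic sequence.\<close>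

locale cyclic_enumeration =
  fixes p :: "int \<Rightarrow> 'n::finite" and z :: 'n and m :: int
  assumes m5: "m \<ge> 5" and odd_m: "odd m"
    and p_eq: "p i = p j \<longleftrightarrow> i mod m = j mod m"
    and p_range: "range p = UNIV - {z}"
begin

lemma m_pos: "m > 0" using m5 by simp

lemma p_neq_z [simp]: "p i \<noteq> z" "z \<noteq> p i"
  using p_range by auto

lemma per_coord: "per m (\<lambda>i. x $ p i)"
  unfolding per_def using p_eq by (metis mod_add_self2)

lemma p_image: "p ` {0..<m} = UNIV - {z}"
proof -
  have "p i \<in> p ` {0..<m}" for i
    using p_eq[of i "i mod m"] m_pos by (auto intro!: image_eqI[of _ _ "i mod m"])
  then have "p ` {0..<m} = range p" by blast
  then show ?thesis using p_range by simp
qed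

lemma p_inj: "inj_on p {0..<m}"
  by (rule inj_onI) (use p_eq in auto)

lemma index_cases:
  obtains "j = z" | i where "i \<in> {0..<m}" "j = p i"
  using p_image by blast

lemma sum_index: "(\<Sum>j\<in>UNIV. g j) = g z + (\<Sum>i\<in>{0..<m}. g (p i))"
proof -
  have "(\<Sum>j\<in>UNIV. g j) = g z + (\<Sum>j\<in>UNIV - {z}. g j)"
    by (simp add: sum.remove)
  also have "(\<Sum>j\<in>UNIV - {z}. g j) = (\<Sum>i\<in>{0..<m}. g (p i))"
    using sum.reindex[OF p_inj, of g] p_image by simp
  finally show ?thesis .
qed

text \<open>Sends periodic sequences back to vectors, where compactness is available. For periodic
  \<open>X\<close> the choice of the index is immaterial.\<close>

definition lift :: "(int \<Rightarrow> real) \<Rightarrow> real ^ 'n" where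
  "lift X = (\<chi> j. if j = z then 0 else X (SOME i. p i = j))"

lemma lift_z [simp]: "lift X $ z = 0"
  by (simp add: lift_def)

lemma lift_p [simp]: "per m X \<Longrightarrow> lift X $ p i = X i"
proof -
  assume X: "per m X"
  have "p (SOME k. p k = p i) = p i" by (rule someI) simp
  then have "X (SOME k. p k = p i) = X i"
    by (intro per_cong[OF X]) (simp only: p_eq)
  then show ?thesis by (simp add: lift_def)
qed

lemma norm_index: "x $ z = 0 \<Longrightarrow> (norm x)\<^sup>2 = (\<Sum>i\<in>{0..<m}. (x $ p i)\<^sup>2)"
  by (simp add: norm_vec_def L2_set_def sum_index sum_nonneg)

lemma vec_eqI: "x $ z = y $ z \<Longrightarrow> (\<And>i. x $ p i = y $ p i) \<Longrightarrow> x = y"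
  by (metis index_cases vec_eq_iff)

section \<open>Compactness bounds for vectors near the kernel\<close>

definition diff_energy :: "real ^ 'n \<Rightarrow> real" where
  "diff_energy x = (\<Sum>i\<in>{0..<m}. (third_diff m (\<lambda>i. x $ p i) i)\<^sup>2)"

lemma diff_energy_nonneg: "diff_energy x \<ge> 0"
  by (simp add: diff_energy_def sum_nonneg)

lemma diff_energy_zero:
  assumes "diff_energy x = 0" shows "third_diff m (\<lambda>i. x $ p i) i = 0"
proof -
  have "\<forall>i\<in>{0..<m}. (third_diff m (\<lambda>i. x $ p i) i)\<^sup>2 = 0"
    using assms unfolding diff_energy_def by (subst (asm) sum_nonneg_eq_0_iff) auto
  then have "third_diff m (\<lambda>i. x $ p i) (i mod m) = 0" using m_pos by simp
  then show ?thesis using per_mod[OF per_third_diff[OF per_coord]] by metis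
qed

lemma continuous_diff_energy: "continuous_on A diff_energy"
  unfolding diff_energy_def third_diff_def by (intro continuous_intros)

lemma diff_energy_bound:
  assumes "compact N" "\<And>x. x \<in> N \<Longrightarrow> diff_energy x \<noteq> 0"
  obtains h where "h > 0" "\<And>x. x \<in> N \<Longrightarrow> h \<le> diff_energy x"
proof (cases "N = {}")
  case True then show ?thesis using that[of 1] by simp
next
  case False
  from continuous_attains_inf[OF assms(1) this continuous_diff_energy] obtain x
    where x: "x \<in> N" "\<And>y. y \<in> N \<Longrightarrow> diff_energy x \<le> diff_energy y" by blast
  have "diff_energy x > 0" using diff_energy_nonneg[of x] assms(2)[OF x(1)] by simp
  then show ?thesis using that x(2) by blast
qed

text \<open>The sign pattern of \<open>window_vec\<close>. It consists of finitely many strict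
  inequalities, so it is an open condition and survives a small perturbation.\<close>

definition window_pos :: "(int \<Rightarrow> real) \<Rightarrow> bool" where
  "window_pos X \<longleftrightarrow> (\<forall>i\<in>{1..m - 2}. 0 < X i) \<and> X 1 < X 2"

definition window_sphere :: "(real ^ 'n) set" where
  "window_sphere = {x. x $ z = 0 \<and> x $ p (-1) = 0 \<and> x $ p 0 = 0} \<inter> sphere 0 1"

lemma compact_window_sphere: "compact window_sphere"
proof -
  have "closed {x::real^'n. x $ z = 0 \<and> x $ p (-1) = 0 \<and> x $ p 0 = 0}"
    by (intro closed_Collect_conj closed_Collect_eq continuous_intros)
  then show ?thesis unfolding window_sphere_def
    by (intro closed_Int_compact) auto
qed

text \<open>Vectors of zero energy in \<open>window_sphere\<close> are multiples of
  \<open>window_vec\<close>, so they have the sign pattern up to sign. On the compact set of vectors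
  without it the energy is therefore bounded away from 0.\<close>

lemma diff_energy_window_bound:
  "\<exists>h>0. \<forall>x\<in>window_sphere. diff_energy x < h \<longrightarrow>
      window_pos (\<lambda>i. x $ p i) \<or> window_pos (\<lambda>i. (-x) $ p i)"
proof -
  let ?P = "{x :: real^'n. window_pos (\<lambda>i. x $ p i)}"
  let ?N = "{x :: real^'n. window_pos (\<lambda>i. (-x) $ p i)}"
  have P: "open ?P" "open ?N"
  proof -
    have "?P = (\<Inter>i\<in>{1..m-2}. {x. 0 < x $ p i}) \<inter> {x. x $ p 1 < x $ p 2}"
      by (auto simp: window_pos_def)
    also have "open \<dots>"
      by (intro open_Int open_INT ballI open_Collect_less continuous_intros) auto
    finally show "open ?P" .
    have "?N = (\<Inter>i\<in>{1..m-2}. {x. 0 < - (x $ p i)}) \<inter> {x. - (x $ p 1) < - (x $ p 2)}"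
      by (auto simp: window_pos_def)
    also have "open \<dots>"
      by (intro open_Int open_INT ballI open_Collect_less continuous_intros) auto
    finally show "open ?N" .
  qed
  have "compact (window_sphere - (?P \<union> ?N))"
    using compact_window_sphere P by (intro compact_diff open_Un)
  moreover have "diff_energy x \<noteq> 0" if x: "x \<in> window_sphere - (?P \<union> ?N)" for x
  proof
    assume "diff_energy x = 0"
    let ?X = "\<lambda>i. x $ p i"
    let ?c = "?X 1 / window_vec m 1"
    have X: "?X i = ?c * window_vec m i" for i
      using x diff_energy_zero[OF \<open>diff_energy x = 0\<close>]
      by (intro third_diff_zero_window[OF per_coord m5]) (auto simp: window_sphere_def)
    have wp: "window_pos Y" if "c > 0" "\<And>i. Y i = c * window_vec m i" for c Y
    proof -
      have "Y = (\<lambda>i. c * window_vec m i)" using that(2) by (rule ext)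
      then show ?thesis using that(1) window_vec_pos window_vec_12 m5 by (auto simp: window_pos_def)
    qed
    consider "?c > 0" | "?c < 0" | "?c = 0" by linarith
    then show False
    proof cases
      case 1
      have "window_pos ?X" by (rule wp[OF 1 X])
      then show ?thesis using x by blast
    next
      case 2
      have "(-x) $ p i = (-?c) * window_vec m i" for i
        unfolding vector_uminus_component mult_minus_left by (subst X) (rule refl)
      moreover have "0 < -?c" using 2 by linarith
      ultimately have "window_pos (\<lambda>i. (-x) $ p i)" by (intro wp[of "-?c"])
      then show ?thesis using x by blast
    next
      case 3
      have "?X i = 0" for i by (subst X) (simp only: 3 mult_zero_left)
      then have "x = 0" using x by (intro vec_eqI) (auto simp: window_sphere_def)
      then show ?thesis using x by (simp add: window_sphere_def)
    qed
  qed
  ultimately obtain h where "h > 0" "\<And>x. x \<in> window_sphere - (?P \<union> ?N) \<Longrightarrow> h \<le> diff_energy x"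
    using diff_energy_bound by blast
  then show ?thesis by force
qed

lemma diff_energy_nonadjacent_bound:
  "\<exists>h>0. \<forall>x b. x \<in> sphere 0 1 \<longrightarrow> x $ z = 0 \<longrightarrow> (\<forall>i. 0 \<le> x $ p i) \<longrightarrow> x $ p 0 = 0 \<longrightarrow>
     2 \<le> b \<longrightarrow> b \<le> m - 2 \<longrightarrow> x $ p b = 0 \<longrightarrow> h \<le> diff_energy x"
proof -
  \<comment> \<open>The index \<open>b\<close> ranges over a finite set, so the union of hyperplanes
    is closed.\<close>
  define N where "N = {x :: real^'n. x $ z = 0 \<and> (\<forall>j. 0 \<le> x $ j) \<and> x $ p 0 = 0} \<inter>
      (\<Union>b\<in>{2..m-2}. {x. x $ p b = 0}) \<inter> sphere 0 1"
  have "compact N"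
    unfolding N_def
    by (intro closed_Int_compact closed_Int closed_UN closed_Collect_conj closed_Collect_all
        closed_Collect_le closed_Collect_eq continuous_intros ballI) auto
  moreover have "diff_energy x \<noteq> 0" if x: "x \<in> N" for x
  proof
    assume "diff_energy x = 0"
    obtain b where "2 \<le> b" "b \<le> m - 2" "x $ p b = 0" using x by (auto simp: N_def)
    moreover have "x $ p 0 = 0" "\<And>i. 0 \<le> x $ p i" using x by (auto simp: N_def)
    ultimately have "x $ p i = 0" for i
      using third_diff_zero_nonadjacent[OF per_coord[of x] m5 diff_energy_zero[OF \<open>diff_energy x = 0\<close>], of b] by blast
    then have "x = 0" using x by (intro vec_eqI) (auto simp: N_def)
    then show False using x by (simp add: N_def)
  qed
  ultimately obtain h where "h > 0" "\<And>x. x \<in> N \<Longrightarrow> h \<le> diff_energy x"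
    using diff_energy_bound by blast
  moreover have "x \<in> N" if "x \<in> sphere 0 1" "x $ z = 0" "\<And>i. 0 \<le> x $ p i" "x $ p 0 = 0"
       "2 \<le> b" "b \<le> m - 2" "x $ p b = 0" for x b
  proof -
    have "0 \<le> x $ j" for j using that(2,3) by (cases j rule: index_cases) auto
    then show ?thesis using that unfolding N_def by auto
  qed
  ultimately show ?thesis by blast
qed


lemma circ_form_coord:
  assumes "x $ z = 0"
  shows "circ_form m t e (\<lambda>i. x $ p i) (\<lambda>i. x $ p i) =
    diff_energy x + t * (\<Sum>i\<in>{0..<m}. x $ p i)\<^sup>2 - e * (norm x)\<^sup>2"
  unfolding norm_index[OF assms] by (simp add: circ_form_def diff_energy_def power2_eq_square)

lemma norm_lift_pos:
  assumes "per m X" "X i \<noteq> 0" shows "norm (lift X) > 0"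
proof -
  have "lift X $ p i \<noteq> 0" using assms by simp
  then show ?thesis by auto
qed

text \<open>\<open>e\<close> is the minimum over \<open>window_sphere\<close> of
  \<open>diff_energy\<close> plus \<open>t\<close> times the squared sum, and \<open>U\<close> is a
  minimiser up to sign. So the form is positive semidefinite on sequences vanishing at -1 and 0; the
  remaining properties come from this, the smallness of \<open>t\<close> and the symmetries.\<close>

lemma base_form:
  obtains U :: "int \<Rightarrow> real" and t e c :: real where
    "per m U" "U (-1) = 0" "U 0 = 0" "\<And>i. 1 \<le> i \<Longrightarrow> i \<le> m - 2 \<Longrightarrow> 0 < U i" "U 1 < U 2"
    "\<And>i. U (- 1 - i) = U i" "c > 0"
    "\<And>Y. per m Y \<Longrightarrow> circ_form m t e U Y = c * (Y (-1) + Y 0)"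
    "\<And>X. per m X \<Longrightarrow> X (-1) = 0 \<Longrightarrow> X 0 = 0 \<Longrightarrow> circ_form m t e X X = 0 \<Longrightarrow> X = (\<lambda>i. X 1 / U 1 * U i)"
    "\<And>X b i. per m X \<Longrightarrow> (\<And>i. 0 \<le> X i) \<Longrightarrow> X 0 = 0 \<Longrightarrow> 2 \<le> b \<Longrightarrow> b \<le> m - 2 \<Longrightarrow> X b = 0
        \<Longrightarrow> X i \<noteq> 0 \<Longrightarrow> 0 < circ_form m t e X X"
proof -
  obtain h1 where h1: "h1 > 0"
    "\<And>x. x \<in> window_sphere \<Longrightarrow> diff_energy x < h1 \<Longrightarrow>
        window_pos (\<lambda>i. x $ p i) \<or> window_pos (\<lambda>i. (-x) $ p i)"
    using diff_energy_window_bound by blast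
  obtain h2 where h2: "h2 > 0"
    "\<And>x b. x \<in> sphere 0 1 \<Longrightarrow> x $ z = 0 \<Longrightarrow> (\<And>i. 0 \<le> x $ p i) \<Longrightarrow> x $ p 0 = 0 \<Longrightarrow>
       2 \<le> b \<Longrightarrow> b \<le> m - 2 \<Longrightarrow> x $ p b = 0 \<Longrightarrow> h2 \<le> diff_energy x"
    using diff_energy_nonadjacent_bound by blast
  \<comment> \<open>Chosen so that \<open>e\<close>, which will be less than t * m, lies below both
    energy bounds.\<close>
  define t where "t = min h1 h2 / m"
  have t: "t > 0" "t * m \<le> h1" "t * m \<le> h2"
    using h1(1) h2(1) m_pos by (auto simp: t_def)
  define G where "G x = diff_energy x + t * (\<Sum>i\<in>{0..<m}. x $ p i)\<^sup>2" for x :: "real ^ 'n"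
  have "continuous_on window_sphere G"
    unfolding G_def by (intro continuous_intros continuous_diff_energy)
  let ?v = "lift (window_vec m)"
  have v1: "window_vec m 1 > 0" using window_vec_pos m5 by simp
  have pv: "per m (window_vec m)" using per_window_vec m_pos .
  have vn: "norm ?v > 0" using v1 by (intro norm_lift_pos[OF pv, of 1]) simp
  define v1 where "v1 = ?v /\<^sub>R norm ?v"
  have v1w: "v1 \<in> window_sphere"
    using vn pv window_vec_zero by (simp add: window_sphere_def v1_def)
  have "diff_energy v1 = 0"
  proof -
    have "third_diff m (\<lambda>i. v1 $ p i) i = 0" for i
      using third_diff_scale[of m "inverse (norm ?v)" "window_vec m" i] pv by (simp add: v1_def third_diff_window_vec)
    then show ?thesis by (simp add: diff_energy_def)
  qed
  \<comment> \<open>Cauchy-Schwarz over the m - 2 positions where \<open>v1\<close> can be nonzero.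
    The strictness later yields \<open>c > 0\<close>.\<close>
  have "G v1 < t * m"
  proof -
    let ?S = "{1..m-2}"
    have S: "(\<Sum>i\<in>{0..<m}. v1 $ p i) = (\<Sum>i\<in>?S. v1 $ p i)"
    proof (rule sum.mono_neutral_right)
      show "\<forall>i\<in>{0..<m} - ?S. v1 $ p i = 0"
      proof
        fix i assume "i \<in> {0..<m} - ?S"
        then have "i = 0 \<or> i = m - 1" using m5 by auto
        then have "p i = p 0 \<or> p i = p (-1)"
          using p_eq[of "m - 1" "-1"] by (auto simp: mod_diff_left_eq[symmetric])
        then show "v1 $ p i = 0" using v1w by (auto simp: window_sphere_def)
      qed
    qed (use m5 in auto)
    have "(\<Sum>i\<in>{0..<m}. v1 $ p i)\<^sup>2 \<le> (\<Sum>i\<in>?S. (v1 $ p i)\<^sup>2) * card ?S"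
      unfolding S by (rule sum_squared_le_sum_of_squares)
    also have "\<dots> \<le> 1 * real_of_int (m - 2)"
    proof (rule mult_mono)
      have "(\<Sum>i\<in>?S. (v1 $ p i)\<^sup>2) \<le> (\<Sum>i\<in>{0..<m}. (v1 $ p i)\<^sup>2)"
        by (rule sum_mono2) auto
      also have "\<dots> = 1" using norm_index[of v1] v1w by (simp add: window_sphere_def)
      finally show "(\<Sum>i\<in>?S. (v1 $ p i)\<^sup>2) \<le> 1" .
    qed (use m5 in auto)
    finally have "G v1 \<le> t * real_of_int (m - 2)"
      using t(1) by (simp add: G_def \<open>diff_energy v1 = 0\<close>)
    also have "\<dots> < t * m" using t(1) by simp
    finally show ?thesis .
  qed
  obtain u where u: "u \<in> window_sphere" "\<And>y. y \<in> window_sphere \<Longrightarrow> G u \<le> G y"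
    using continuous_attains_inf[OF compact_window_sphere _ \<open>continuous_on window_sphere G\<close>] v1w by blast
  define e where "e = G u"
  have e: "0 \<le> e" "e < t * m"
    using u(2)[OF v1w] \<open>G v1 < t * m\<close> t(1) diff_energy_nonneg[of u] by (auto simp: e_def G_def)
  let ?b = "circ_form m t e"
  have unit: "?b (\<lambda>i. x $ p i) (\<lambda>i. x $ p i) = G x - e" if "x $ z = 0" "norm x = 1" for x
    using circ_form_coord[OF that(1), of t e] that(2) by (simp add: G_def)
  have minimiser_pos: "window_pos (\<lambda>i. x $ p i) \<or> window_pos (\<lambda>i. (-x) $ p i)"
    if "x \<in> window_sphere" "G x = e" for x
  proof (rule h1(2)[OF that(1)])
    have "diff_energy x \<le> G x" using t(1) by (simp add: G_def)
    then show "diff_energy x < h1" using that(2) e t by linarith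
  qed
  have scaled: "?b X X = (norm (lift X))\<^sup>2 * (G (lift X /\<^sub>R norm (lift X)) - e)"
    if "per m X" "X i \<noteq> 0" for X i
  proof -
    let ?r = "norm (lift X)"
    have r: "?r > 0" using norm_lift_pos that .
    have "X = (\<lambda>i. ?r * (lift X /\<^sub>R ?r) $ p i)"
      using r that(1) by (intro ext) simp
    then have "?b X X = ?b (\<lambda>i. ?r * (lift X /\<^sub>R ?r) $ p i) (\<lambda>i. ?r * (lift X /\<^sub>R ?r) $ p i)"
      by metis
    also have "\<dots> = ?r\<^sup>2 * ?b (\<lambda>i. (lift X /\<^sub>R ?r) $ p i) (\<lambda>i. (lift X /\<^sub>R ?r) $ p i)"
      by (simp only: circ_form_scale_left circ_form_scale_right power2_eq_square mult.assoc)
    also have "?b (\<lambda>i. (lift X /\<^sub>R ?r) $ p i) (\<lambda>i. (lift X /\<^sub>R ?r) $ p i) = G (lift X /\<^sub>R ?r) - e"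
      using r by (intro unit) auto
    finally show ?thesis .
  qed
  have window: "lift X /\<^sub>R norm (lift X) \<in> window_sphere"
    if "per m X" "X (-1) = 0" "X 0 = 0" "X i \<noteq> 0" for X i
    using norm_lift_pos[OF that(1,4)] that by (simp add: window_sphere_def)
  have psd: "0 \<le> ?b X X" if X: "per m X" "X (-1) = 0" "X 0 = 0" for X
  proof (cases "\<exists>i. X i \<noteq> 0")
    case True
    then obtain i where i: "X i \<noteq> 0" by blast
    show ?thesis using scaled[OF X(1) i] u(2)[OF window[OF X i]] by (simp add: e_def)
  next
    case False
    then show ?thesis by (simp add: circ_form_def third_diff_def)
  qed
  have null_pos: "window_pos X \<or> window_pos (\<lambda>i. - X i)"
    if X: "per m X" "X (-1) = 0" "X 0 = 0" "?b X X = 0" "X i \<noteq> 0" for X i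
  proof -
    let ?r = "norm (lift X)"
    have r: "?r > 0" using norm_lift_pos X by blast
    have "G (lift X /\<^sub>R ?r) = e" using scaled[OF X(1,5)] X(4) r by simp
    from minimiser_pos[OF window[OF X(1-3,5)] this] r X(1) show ?thesis
      by (auto simp: window_pos_def field_simps)
  qed
  \<comment> \<open>A null vector of a semidefinite form is orthogonal to the space on which the
    form is semidefinite.\<close>
  have null_bilinear: "?b U Y = 0"
    if U: "per m U" "U (-1) = 0" "U 0 = 0" "?b U U = 0" and Y: "per m Y" "Y (-1) = 0" "Y 0 = 0" for U Y
  proof (rule ccontr)
    assume n: "?b U Y \<noteq> 0"
    \<comment> \<open>As the form vanishes at \<open>U\<close>, its value at Y + s U is affine in s;
      this s makes it -1.\<close>
    define s where "s = - (?b Y Y + 1) / (2 * ?b U Y)"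
    have "per m (\<lambda>i. Y i + s * U i)" using U Y by (simp add: per_def)
    then have "0 \<le> ?b (\<lambda>i. Y i + s * U i) (\<lambda>i. Y i + s * U i)"
      using U Y by (intro psd) auto
    also have "\<dots> = -1"
      unfolding circ_form_quad_add U(4) s_def using n by (simp add: field_simps)
    finally show False by simp
  qed
  define U where "U = (if window_pos (\<lambda>i. u $ p i) then (\<lambda>i. u $ p i) else (\<lambda>i. (-u) $ p i))"
  have uz: "u $ z = 0" "norm u = 1" "u $ p (-1) = 0" "u $ p 0 = 0"
    using u(1) by (auto simp: window_sphere_def)
  have perU: "per m U" unfolding U_def using per_coord[of u] per_coord[of "-u"] by simp
  have U0: "U (-1) = 0" "U 0 = 0" using uz by (auto simp: U_def)
  have "?b (\<lambda>i. (-u) $ p i) (\<lambda>i. (-u) $ p i) = ?b (\<lambda>i. u $ p i) (\<lambda>i. u $ p i)"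
    using circ_form_scale_left[of m t e "-1" "\<lambda>i. u $ p i"] circ_form_scale_right[of m t e _ "-1" "\<lambda>i. u $ p i"]
    by simp
  then have bU: "?b U U = 0" using unit[OF uz(1,2)] by (simp add: U_def e_def)
  have Upos: "window_pos U" using minimiser_pos[OF u(1)] by (auto simp: U_def e_def)
  have Upos': "0 < U i" if "1 \<le> i" "i \<le> m - 2" for i using Upos that by (simp add: window_pos_def)
  have U1: "U 1 > 0" using Upos' m5 by simp
  have null: "X i = X 1 / U 1 * U i"
    if X: "per m X" "X (-1) = 0" "X 0 = 0" "?b X X = 0" for X i
  proof (rule ccontr)
    assume n: "X i \<noteq> X 1 / U 1 * U i"
    \<comment> \<open>X + s U is again null but vanishes at 1, which the strict sign pattern forbids
      for a nonzero null vector.\<close>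
    define s where "s = - (X 1 / U 1)"
    have "window_pos (\<lambda>i. X i + s * U i) \<or> window_pos (\<lambda>i. - (X i + s * U i))"
    proof (rule null_pos)
      show "per m (\<lambda>i. X i + s * U i)" using X(1) perU by (simp add: per_def)
      show "X i + s * U i \<noteq> 0" using n by (simp add: s_def)
      show "?b (\<lambda>i. X i + s * U i) (\<lambda>i. X i + s * U i) = 0"
        unfolding circ_form_quad_add X(4) bU using null_bilinear[OF perU U0 bU X(1-3)] by simp
    qed (use X U0 in auto)
    moreover have "X 1 + s * U 1 = 0" using U1 by (simp add: s_def)
    moreover have "1 \<in> {1..m - 2}" using m5 by simp
    ultimately show False unfolding window_pos_def by force
  qed
  \<comment> \<open>The reflection exchanges -1 and 0, so it maps \<open>U\<close> to a null vector
    s U of the same window. Reflecting twice gives s^2 = 1, and positivity excludes -1.\<close>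
  have reflect: "U (- 1 - i) = U i" for i
  proof -
    let ?R = "\<lambda>i. U (- 1 - i)"
    have R: "per m ?R" using per_reflect[OF perU] .
    have bR: "?b ?R ?R = 0" using circ_form_reflect[OF perU perU m_pos, of t e "-1"] bU by simp
    define s where "s = ?R 1 / U 1"
    have Rs: "?R i = s * U i" for i
      using null[OF R _ _ bR, of i] U0 by (simp add: s_def)
    have "?R (- 1 - 1) = s * ?R 1" using Rs[of "-2"] by simp
    then have "U 1 = s * (s * U 1)" using Rs[of 1] by simp
    then have "s\<^sup>2 = 1" using U1 by (simp add: power2_eq_square)
    moreover have "s \<ge> 0"
    proof -
      have "U (- 1 - 1) = U (m - 2)" by (rule per_cong[OF perU]) (simp add: mod_diff_left_eq[symmetric])
      then have "?R 1 > 0" using Upos'[of "m - 2"] m5 by simp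
      then show ?thesis using U1 by (simp add: s_def)
    qed
    ultimately have "s = 1" by (simp add: power2_eq_1_iff)
    then show ?thesis using Rs by simp
  qed
  \<comment> \<open>Unit sequences. Pairing with \<open>U\<close> vanishes on the window subspace,
    so it depends only on the entries at -1 and 0, with equal weights by reflection.\<close>
  define d where "d k i = (if i mod m = k mod m then 1 else 0 :: real)" for k i :: int
  have perd: "per m (d k)" for k by (simp add: per_def d_def)
  have dd: "d (-1) 0 = 0" "d 0 (-1) = 0" "d 0 0 = 1" "d (-1) (-1) = 1"
    using m5 by (auto simp: d_def zmod_minus1)
  define c where "c = ?b U (d 0)"
  have c': "?b U (d (-1)) = c"
  proof -
    have "(\<lambda>i. d 0 (- 1 - i)) = d (-1)"
    proof
      fix i
      have "((- 1 - i) mod m = 0) = (i mod m = (-1) mod m)"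
        by (metis diff_0_right dvd_minus_iff minus_diff_eq mod_0_imp_dvd mod_eq_dvd_iff dvd_imp_mod_0 uminus_add_conv_diff diff_minus_eq_add add.commute)
      then show "d 0 (- 1 - i) = d (-1) i" by (simp add: d_def)
    qed
    moreover have "(\<lambda>i. U (- 1 - i)) = U" using reflect by (intro ext)
    ultimately show ?thesis using circ_form_reflect[OF perU perd[of 0] m_pos, of t e "-1"]
      by (simp add: c_def)
  qed
  have expand: "?b U Y = c * (Y (-1) + Y 0)" if Y: "per m Y" for Y
  proof -
    let ?Z = "\<lambda>i. Y i + (- Y (-1)) * d (-1) i + (- Y 0) * d 0 i"
    have "?b U ?Z = 0"
      by (rule null_bilinear[OF perU U0 bU]) (use Y perd dd in \<open>auto simp: per_def\<close>)
    then show ?thesis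
      unfolding circ_form_add_right circ_form_scale_right c' c_def[symmetric] by (simp add: algebra_simps)
  qed
  \<comment> \<open>Pairing \<open>U\<close> with the constant 1, which \<open>third_diff\<close>
    annihilates, gives 2 c on one side and (t m - e) times the positive sum of \<open>U\<close> on
    the other.\<close>
  have "c > 0"
  proof -
    let ?S = "\<Sum>i\<in>{0..<m}. U i"
    have "?S > 0"
    proof (rule sum_pos2[of _ 1])
      show "0 \<le> U i" if "i \<in> {0..<m}" for i
      proof -
        have "i = 0 \<or> i = m - 1 \<or> (1 \<le> i \<and> i \<le> m - 2)" using that by auto
        moreover have "U (m - 1) = U (-1)"
          by (rule per_cong[OF perU]) (simp add: mod_diff_left_eq[symmetric])
        ultimately show ?thesis using Upos'[of i] U0 by fastforce
      qed
    qed (use U1 m5 in auto)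
    moreover have "?b U (\<lambda>_. 1) = (t * m - e) * ?S"
      by (simp add: circ_form_def third_diff_def algebra_simps m_pos less_imp_le)
    moreover have "?b U (\<lambda>_. 1) = c * 2" using expand[of "\<lambda>_. 1"] by (simp add: per_def)
    ultimately show ?thesis using e(2) by (smt (verit) mult_pos_pos)
  qed
  \<comment> \<open>After normalisation \<open>diff_energy\<close> alone exceeds \<open>e\<close>,
    because h2 is at least t m > e.\<close>
  have nonadj: "0 < ?b X X"
    if X: "per m X" "\<And>i. 0 \<le> X i" "X 0 = 0" "2 \<le> b" "b \<le> m - 2" "X b = 0" "X i \<noteq> 0" for X b i
  proof -
    let ?x = "lift X /\<^sub>R norm (lift X)"
    have r: "norm (lift X) > 0" using norm_lift_pos X by blast
    have "h2 \<le> diff_energy ?x"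
      by (rule h2(2)[of _ b]) (use r X in auto)
    also have "\<dots> \<le> G ?x" using t(1) by (simp add: G_def)
    finally have "0 < G ?x - e" using e t(3) by linarith
    then show ?thesis using scaled[OF X(1,7)] r by simp
  qed
  show ?thesis
  proof (rule that[of U c t e])
    show "U 1 < U 2" using Upos by (simp add: window_pos_def)
    show "X = (\<lambda>i. X 1 / U 1 * U i)"
      if "per m X" "X (-1) = 0" "X 0 = 0" "?b X X = 0" for X
      using null[OF that] by (rule ext)
  qed (use perU U0 Upos' reflect \<open>c > 0\<close> expand nonadj in auto)
qed

end

section \<open>Copositivity and zeros\<close>

text \<open>Fixes one outcome of the construction, so that later definitions can refer to
  \<open>U\<close> and to the form.\<close>

locale base_form = cyclic_enumeration +
  fixes U :: "int \<Rightarrow> real" and t e c :: real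
  assumes per_U: "per m U" and U_m1: "U (-1) = 0" and U_0: "U 0 = 0"
    and U_pos: "\<And>i. 1 \<le> i \<Longrightarrow> i \<le> m - 2 \<Longrightarrow> 0 < U i" and U_12: "U 1 < U 2"
    and U_reflect: "\<And>i. U (- 1 - i) = U i" and c_pos: "c > 0"
    and b_U: "\<And>Y. per m Y \<Longrightarrow> circ_form m t e U Y = c * (Y (-1) + Y 0)"
    and b_window_null: "\<And>X. per m X \<Longrightarrow> X (-1) = 0 \<Longrightarrow> X 0 = 0 \<Longrightarrow> circ_form m t e X X = 0
        \<Longrightarrow> X = (\<lambda>i. X 1 / U 1 * U i)"
    and b_nonadjacent: "\<And>X b i. per m X \<Longrightarrow> (\<And>i. 0 \<le> X i) \<Longrightarrow> X 0 = 0 \<Longrightarrow> 2 \<le> b \<Longrightarrow> b \<le> m - 2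
        \<Longrightarrow> X b = 0 \<Longrightarrow> X i \<noteq> 0 \<Longrightarrow> 0 < circ_form m t e X X"

lemma (in cyclic_enumeration) base_form_exists:
  obtains U t e c where "base_form p z m U t e c"
proof (rule base_form)
  fix U t e c
  assume *: "per m U" "U (-1) = 0" "U 0 = 0" "\<And>i. 1 \<le> i \<Longrightarrow> i \<le> m - 2 \<Longrightarrow> 0 < U i" "U 1 < U 2"
    "\<And>i. U (- 1 - i) = U i" "0 < c"
    "\<And>Y. per m Y \<Longrightarrow> circ_form m t e U Y = c * (Y (-1) + Y 0)"
    "\<And>X. per m X \<Longrightarrow> X (-1) = 0 \<Longrightarrow> X 0 = 0 \<Longrightarrow> circ_form m t e X X = 0 \<Longrightarrow> X = (\<lambda>i. X 1 / U 1 * U i)"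
    "\<And>X b i. per m X \<Longrightarrow> (\<And>i. 0 \<le> X i) \<Longrightarrow> X 0 = 0 \<Longrightarrow> 2 \<le> b \<Longrightarrow> b \<le> m - 2 \<Longrightarrow> X b = 0
        \<Longrightarrow> X i \<noteq> 0 \<Longrightarrow> 0 < circ_form m t e X X"
  have "base_form p z m U t e c"
    by (intro base_form.intro cyclic_enumeration_axioms base_form_axioms.intro) (fact *)+
  then show ?thesis by (rule that)
qed

context base_form
begin

abbreviation b :: "(int \<Rightarrow> real) \<Rightarrow> (int \<Rightarrow> real) \<Rightarrow> real" where
  "b \<equiv> circ_form m t e"

lemma U_mod: "U i = U (i mod m)"
  using per_mod[OF per_U] by simp

lemma mod_cases: "i mod m = 0 \<or> i mod m = m - 1 \<or> (1 \<le> i mod m \<and> i mod m \<le> m - 2)"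
proof -
  have "0 \<le> i mod m" "i mod m < m" using m_pos by auto
  then show ?thesis by linarith
qed

lemma U_last: "U (m - 1) = 0"
  using per_cong[OF per_U, of "m - 1" "-1"] U_m1 by (simp add: mod_diff_left_eq[symmetric])

lemma U_nonneg: "0 \<le> U i"
  using mod_cases[of i] U_0 U_last U_pos[of "i mod m"] U_mod[of i] by auto

lemma U_nonzero_iff: "U i \<noteq> 0 \<longleftrightarrow> 1 \<le> i mod m \<and> i mod m \<le> m - 2"
  using mod_cases[of i] U_0 U_last U_pos[of "i mod m"] U_mod[of i] by auto

lemma U_1: "U 1 > 0" using U_pos m5 by simp

lemma per_shift_U: "per m (\<lambda>i. U (i - k))"
  by (rule per_shift'[OF per_U])

lemma b_shift_U:
  assumes "per m Y" shows "b (\<lambda>i. U (i - k)) Y = c * (Y (k - 1) + Y k)"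
proof -
  have "b U (\<lambda>i. Y (i + k)) = b (\<lambda>i. U (i - k)) Y"
    using circ_form_shift[OF per_shift_U assms m_pos, of t e k k] by simp
  then show ?thesis using b_U[OF per_shift[OF assms], of k] by (simp add: add.commute)
qed

lemma b_shift_U_null: "b (\<lambda>i. U (i - k)) (\<lambda>i. U (i - k)) = 0"
  using b_shift_U[OF per_shift_U, of k k] U_0 U_m1 by simp

lemma window_null_multiple:
  assumes X: "per m X" "\<And>i. 0 \<le> X i" "X (k - 1) = 0" "X k = 0" "b X X = 0"
  shows "\<exists>k\<in>{0..<m}. \<exists>s\<ge>0. X = (\<lambda>i. s * U (i - k))"
proof -
  let ?Y = "\<lambda>i. X (i + k)"
  have bY: "b ?Y ?Y = 0" using circ_form_shift[OF X(1) X(1) m_pos] X(5) by simp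
  have Y: "?Y i = ?Y 1 / U 1 * U i" for i
    using b_window_null[OF per_shift[OF X(1)] _ _ bY] X(3,4)
    by (simp add: add.commute) metis
  have "X i = X (1 + k) / U 1 * U (i - k mod m)" for i
  proof -
    have "U (i - k) = U (i - k mod m)" by (rule per_cong[OF per_U]) (simp add: mod_diff_right_eq)
    then show ?thesis using Y[of "i - k"] by simp
  qed
  moreover have "X (1 + k) / U 1 \<ge> 0" using X(2) U_1 by simp
  moreover have "k mod m \<in> {0..<m}" using m_pos by simp
  ultimately show ?thesis by blast
qed

text \<open>The hypothesis gives a zero outside every pair of cyclically adjacent positions.
  Starting at a zero \<open>a\<close> and applying it at most twice yields two zeros that are not
  neighbours.\<close>

lemma nonadjacent_zeros:
  assumes X: "per m X" and N: "\<And>k. \<exists>i. U (i - k) \<noteq> 0 \<and> X i = 0"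
  shows "\<exists>a d. 2 \<le> d \<and> d \<le> m - 2 \<and> X a = 0 \<and> X (a + d) = 0"
proof -
  have step: "\<exists>d. 1 \<le> d \<and> d \<le> m - 2 \<and> X (k + d) = 0" for k
  proof -
    obtain i where i: "U (i - k) \<noteq> 0" "X i = 0" using N by blast
    have "X (k + (i - k) mod m) = X i" by (rule per_cong[OF X]) (simp add: mod_add_right_eq)
    then show ?thesis using i U_nonzero_iff[of "i - k"] by metis
  qed
  have wit: ?thesis if "2 \<le> d" "d \<le> m - 2" "X a = 0" "X (a + d) = 0" for a d
    using that by blast
  obtain a where a: "X a = 0" using N by blast
  obtain d where d: "1 \<le> d" "d \<le> m - 2" "X (a + d) = 0" using step by blast
  show ?thesis
  proof (cases "d = 1")
    case False
    then show ?thesis using a d by (intro wit[of d a]) auto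
  next
    case True
    obtain f where f: "1 \<le> f" "f \<le> m - 2" "X (a + 1 + f) = 0" using step by blast
    show ?thesis
    proof (cases "f = m - 2")
      case False
      then show ?thesis using a f by (intro wit[of "f + 1" a]) (auto simp: algebra_simps)
    next
      \<comment> \<open>Here a + 1 + f is a - 1 modulo m, so a - 1 and a + 1 are zeros at distance
        2.\<close>
      case True
      have "X (a - 1) = X (a + 1 + f)"
        by (rule per_cong[OF X]) (simp add: True mod_eq_dvd_iff)
      then show ?thesis using f(3) d(3) \<open>d = 1\<close> m5
        by (intro wit[of 2 "a - 1"]) (auto simp: add.commute)
    qed
  qed
qed

text \<open>Induction on the size of the support. If the support contains that of a shift of
  \<open>U\<close>, a multiple of this shift can be subtracted; otherwise there are two nonadjacent
  zeros and the form is positive unless \<open>X\<close> is zero.\<close>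

lemma copositive_base:
  assumes "per m X" "\<And>i. 0 \<le> X i"
  shows "0 \<le> b X X \<and> (b X X = 0 \<longrightarrow> (\<exists>k\<in>{0..<m}. \<exists>s\<ge>0. X = (\<lambda>i. s * U (i - k))))"
  using assms
proof (induction "card {i \<in> {0..<m}. X i \<noteq> 0}" arbitrary: X rule: less_induct)
  case less
  note X = less.prems
  show ?case
  proof (cases "\<exists>k. \<forall>i. U (i - k) \<noteq> 0 \<longrightarrow> X i \<noteq> 0")
    case True
    then obtain k where k: "\<And>i. U (i - k) \<noteq> 0 \<Longrightarrow> X i \<noteq> 0" by blast
    let ?I = "{i \<in> {0..<m}. U (i - k) \<noteq> 0}"
    \<comment> \<open>The largest multiple whose subtraction keeps \<open>X\<close> nonnegative; it
      creates a new zero at a minimising index.\<close>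
    define s where "s = Min ((\<lambda>i. X i / U (i - k)) ` ?I)"
    have "U ((k + 1) mod m - k) = U 1"
      by (rule per_cong[OF per_U]) (simp add: mod_diff_left_eq)
    then have "(k + 1) mod m \<in> ?I" using U_1 m_pos by simp
    then have ne: "?I \<noteq> {}" by blast
    have fin: "finite ?I" by (rule finite_subset[of _ "{0..<m}"]) auto
    have "s \<in> (\<lambda>i. X i / U (i - k)) ` ?I" unfolding s_def using ne fin by (intro Min_in finite_imageI) simp_all
    then obtain j where j: "j \<in> ?I" "s = X j / U (j - k)" by blast
    have s_le: "s \<le> X i / U (i - k)" if "i \<in> ?I" for i unfolding s_def using that fin by (intro Min_le finite_imageI imageI)
    have s_pos: "0 \<le> s" using j X(2) U_nonneg by simp
    let ?Y = "\<lambda>i. X i + (-s) * U (i - k)"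
    have perY: "per m ?Y" using X(1) per_shift_U[of k] by (simp add: per_def)
    have Y0: "0 \<le> ?Y i" if "i \<in> {0..<m}" for i
    proof (cases "U (i - k) = 0")
      case True then show ?thesis using X(2) by simp
    next
      case False
      then have "0 < U (i - k)" using U_nonneg[of "i - k"] by simp
      then show ?thesis using s_le[of i] that False by (simp add: field_simps)
    qed
    have Ynn: "0 \<le> ?Y i" for i
      using Y0[of "i mod m"] per_mod[OF perY, of i] m_pos by simp
    have "{i \<in> {0..<m}. ?Y i \<noteq> 0} \<subset> {i \<in> {0..<m}. X i \<noteq> 0}"
    proof
      show "{i \<in> {0..<m}. ?Y i \<noteq> 0} \<subseteq> {i \<in> {0..<m}. X i \<noteq> 0}" using k by force
      have "?Y j = 0" using j by simp
      moreover have "X j \<noteq> 0" using j k by simp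
      ultimately show "{i \<in> {0..<m}. ?Y i \<noteq> 0} \<noteq> {i \<in> {0..<m}. X i \<noteq> 0}" using j(1) by blast
    qed
    then have "card {i \<in> {0..<m}. ?Y i \<noteq> 0} < card {i \<in> {0..<m}. X i \<noteq> 0}"
      by (rule psubset_card_mono[rotated]) (rule finite_subset[of _ "{0..<m}"], auto)
    then have IH: "0 \<le> b ?Y ?Y" using less.hyps[of ?Y] perY Ynn by blast
    have eq: "b X X = b ?Y ?Y + 2 * s * c * (X (k - 1) + X k)"
      unfolding circ_form_quad_add b_shift_U_null b_shift_U[OF X(1)] by simp
    have nn: "0 \<le> 2 * s * c * (X (k - 1) + X k)" using s_pos c_pos X(2) by simp
    \<comment> \<open>A vanishing value forces the nonnegative cross term to vanish, hence X (k - 1)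
      = X k = 0 as s > 0. Then \<open>X\<close> is null on that window.\<close>
    have "\<exists>k\<in>{0..<m}. \<exists>s\<ge>0. X = (\<lambda>i. s * U (i - k))" if "b X X = 0"
    proof (rule window_null_multiple[OF X _ _ that])
      have "s \<noteq> 0" using j k[of j] by simp
      then have "0 < s" using s_pos by simp
      moreover have "2 * s * c * (X (k - 1) + X k) = 0" using eq IH nn that by linarith
      ultimately have "X (k - 1) + X k = 0" using c_pos by simp
      then show "X (k - 1) = 0" "X k = 0" using X(2)[of k] X(2)[of "k - 1"] by auto
    qed
    then show ?thesis using eq IH nn by linarith
  next
    case False
    then obtain a d where ad: "2 \<le> d" "d \<le> m - 2" "X a = 0" "X (a + d) = 0"
      using nonadjacent_zeros[OF X(1)] by blast
    show ?thesis
    proof (cases "\<exists>i. X i \<noteq> 0")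
      case True
      then obtain i where i: "X i \<noteq> 0" by blast
      have "0 < b (\<lambda>i. X (i + a)) (\<lambda>i. X (i + a))"
        by (rule b_nonadjacent[OF per_shift[OF X(1)], of a d "i - a"])
          (use X(2) ad i in \<open>auto simp: add.commute\<close>)
      then show ?thesis using circ_form_shift[OF X(1) X(1) m_pos, of t e a] by simp
    next
      case False
      then have "X = (\<lambda>i. 0 * U (i - 0))" by auto
      moreover have "b X X = 0" using False by (simp add: circ_form_def third_diff_def)
      moreover have "(0::int) \<in> {0..<m}" using m_pos by simp
      ultimately show ?thesis by (metis order_refl)
    qed
  qed
qed

section \<open>The form of order n and its zeros\<close>

text \<open>\<open>g\<close> is the base form pulled back along \<open>merge_last\<close>, whose kernel is spanned by \<open>q\<close>.\<close>

definition W :: "int \<Rightarrow> real" where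
  "W i = (if 4 \<le> i mod m then 1 else 0)"

lemma per_W: "per m W" by (simp add: per_def W_def)

definition u :: "int \<Rightarrow> real ^ 'a" where "u k = lift (\<lambda>i. U (i - k))"

definition q :: "real ^ 'a" where "q = axis z 1 - lift W"

definition merge_last :: "real ^ 'a \<Rightarrow> int \<Rightarrow> real" where
  "merge_last x i = x $ p i + x $ z * W i"

definition g :: "real ^ 'a \<Rightarrow> real ^ 'a \<Rightarrow> real" where
  "g x y = b (merge_last x) (merge_last y)"

lemma u_p: "u k $ p i = U (i - k)" and u_z: "u k $ z = 0"
  using per_shift_U by (simp_all add: u_def)

lemma q_p: "q $ p i = - W i" and q_z: "q $ z = 1"
  using per_W by (simp_all add: q_def axis_def)

lemma u_nonneg: "0 \<le> u k $ j"
  by (cases j rule: index_cases) (simp_all add: u_p u_z U_nonneg)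

lemma per_merge_last: "per m (merge_last x)"
  using per_coord[of x] per_W by (simp add: per_def merge_last_def)

lemma merge_last_add: "merge_last (x + y) = (\<lambda>i. merge_last x i + merge_last y i)"
  and merge_last_scale: "merge_last (r *\<^sub>R x) = (\<lambda>i. r * merge_last x i)"
  by (auto simp: merge_last_def algebra_simps)

lemma merge_last_u: "merge_last (u k) = (\<lambda>i. U (i - k))" and merge_last_q: "merge_last q = (\<lambda>i. 0)"
  by (auto simp: merge_last_def u_p u_z q_p q_z)

lemma bilinear_g: "bilinear g"
  unfolding bilinear_def
  by (intro conjI allI linearI)
    (simp_all add: g_def merge_last_add merge_last_scale circ_form_add_left circ_form_add_right circ_form_scale_left circ_form_scale_right)

lemma g_nonneg:
  assumes "\<And>j. 0 \<le> x $ j" shows "0 \<le> g x x"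
  using copositive_base[OF per_merge_last, of x] assms by (simp add: g_def merge_last_def W_def)

text \<open>The merged sequence is a zero of the base form, so x = s u_k + r q with r the last
  coordinate. If r > 0, nonnegativity demands that the shift of \<open>U\<close> be positive
  wherever \<open>W\<close> is 1, so its zeros k - 1 and k must lie among the residues 0 to
  3.\<close>

lemma g_zeros:
  assumes nn: "\<And>j. 0 \<le> x $ j" and z: "g x x = 0"
  shows "(\<exists>k\<in>{0..<m}. \<exists>s\<ge>0. x = s *\<^sub>R u k) \<or>
    (\<exists>k\<in>{1..3}. \<exists>s r. x = s *\<^sub>R u k + r *\<^sub>R q)"
proof -
  have "0 \<le> merge_last x i" for i using nn by (simp add: merge_last_def W_def)
  with copositive_base[OF per_merge_last this] z obtain k s where k: "k \<in> {0..<m}" "s \<ge> 0"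
    and L: "merge_last x = (\<lambda>i. s * U (i - k))" by (auto simp: g_def)
  let ?r = "x $ z"
  have xp: "x $ p i = s * U (i - k) - ?r * W i" for i
    using fun_cong[OF L, of i] by (simp add: merge_last_def)
  have x: "x = s *\<^sub>R u k + ?r *\<^sub>R q"
    by (rule vec_eqI) (simp_all add: u_p u_z q_p q_z xp)
  show ?thesis
  proof (cases "?r = 0")
    case True
    then show ?thesis using x k by (metis add.right_neutral scale_zero_left)
  next
    case False
    then have r: "?r > 0" using nn[of z] by simp
    have ne: "U (i - k) \<noteq> 0" if "4 \<le> i mod m" for i
    proof
      assume "U (i - k) = 0"
      then have "x $ p i < 0" using xp[of i] r that by (simp add: W_def)
      then show False using nn[of "p i"] by simp
    qed
    have "(m - 1) mod m = m - 1" using m5 by (intro mod_pos_pos_trivial) auto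
    \<comment> \<open>The shift by 0 vanishes at m - 1, and the shift by k vanishes at k;
      \<open>W\<close> is 1 at m - 1 and at every k from 4 on.\<close>
    then have "k \<noteq> 0" using ne[of "m - 1"] U_last m5 by auto
    moreover have "k < 4" using ne[of k] U_0 k(1) by force
    ultimately have "k \<in> {1..3}" using k(1) by auto
    then show ?thesis using x by blast
  qed
qed

text \<open>For k = 1, 2, 3 the zeros k - 1 and k of the shifted \<open>U\<close> avoid the support
  of \<open>W\<close>, so a large multiple of \<open>u k\<close> dominates \<open>W\<close>.\<close>

lemma large_zero:
  obtains s0 where "\<And>k s. k \<in> {1..3} \<Longrightarrow> s \<ge> s0 \<Longrightarrow> 0 < s \<and> (\<forall>j. 0 \<le> (s *\<^sub>R u k + q) $ j) \<and>
     g (s *\<^sub>R u k + q) (s *\<^sub>R u k + q) = 0 \<and> (\<forall>i. U (i - k) \<noteq> 0 \<longrightarrow> 0 < (s *\<^sub>R u k + q) $ p i)"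
proof -
  define h where "h = Min (U ` {1..m-2})"
  have "h \<in> U ` {1..m-2}" unfolding h_def using m5 by (intro Min_in) auto
  then have h: "h > 0" using U_pos by auto
  have hle: "h \<le> U i" if "U i \<noteq> 0" for i
  proof -
    have "i mod m \<in> {1..m-2}" using that U_nonzero_iff[of i] by simp
    then have "h \<le> U (i mod m)" unfolding h_def by (intro Min_le) auto
    then show ?thesis using U_mod by metis
  qed
  show ?thesis
  \<comment> \<open>\<open>h\<close> is the smallest nonzero value of \<open>U\<close>, so this
    makes s * h at least 2, strictly above the maximum 1 of \<open>W\<close>.\<close>
  proof (rule that[of "2 / h"])
    fix k s assume k: "k \<in> {1..3::int}" and s: "s \<ge> 2 / h"
    have sp: "0 < s" using s h by (smt (verit) divide_pos_pos)
    have sh: "s * h \<ge> 2" using s h by (simp add: field_simps)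
    have pos: "0 < (s *\<^sub>R u k + q) $ p i" if "U (i - k) \<noteq> 0" for i
    proof -
      have "s * h \<le> s * U (i - k)" using hle[OF that] sp by simp
      moreover have "W i \<le> 1" by (simp add: W_def)
      ultimately show ?thesis using sh by (simp add: u_p q_p)
    qed
    have W0: "W i = 0" if "U (i - k) = 0" for i
    proof (rule ccontr)
      assume "W i \<noteq> 0"
      then have "4 \<le> i mod m" by (auto simp: W_def split: if_splits)
      moreover have "i mod m < m" using m_pos by simp
      moreover have "(i - k) mod m = (i mod m - k) mod m" by (simp add: mod_diff_left_eq)
      ultimately have "(i - k) mod m = i mod m - k" using k by (simp add: mod_pos_pos_trivial)
      then have "U (i - k) \<noteq> 0"
        using \<open>4 \<le> i mod m\<close> \<open>i mod m < m\<close> k by (auto simp: U_nonzero_iff)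
      then show False using that by simp
    qed
    have nnp: "0 \<le> (s *\<^sub>R u k + q) $ p i" for i
      using pos[of i] W0[of i] by (cases "U (i - k) = 0") (auto simp: u_p q_p)
    have "0 \<le> (s *\<^sub>R u k + q) $ j" for j
      using nnp by (cases j rule: index_cases) (auto simp: u_z q_z)
    moreover have "g (s *\<^sub>R u k + q) (s *\<^sub>R u k + q) = 0"
      unfolding g_def merge_last_add merge_last_scale merge_last_u merge_last_q
      by (simp add: circ_form_scale_left circ_form_scale_right b_shift_U_null)
    ultimately show "0 < s \<and> (\<forall>j. 0 \<le> (s *\<^sub>R u k + q) $ j) \<and>
     g (s *\<^sub>R u k + q) (s *\<^sub>R u k + q) = 0 \<and> (\<forall>i. U (i - k) \<noteq> 0 \<longrightarrow> 0 < (s *\<^sub>R u k + q) $ p i)"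
      using sp pos by blast
  qed
qed

end

section \<open>The zeros determine the form\<close>

text \<open>Both directions along a positive coordinate stay in the orthant for a short while, so
  the first-order term at a zero must vanish.\<close>

lemma copositive_zero_stationary:
  fixes \<beta> :: "real ^ 'n::finite \<Rightarrow> real ^ 'n \<Rightarrow> real"
  assumes bil: "bilinear \<beta>" and sym: "\<And>x y. \<beta> x y = \<beta> y x"
    and cop: "\<And>x. (\<And>j. 0 \<le> x $ j) \<Longrightarrow> 0 \<le> \<beta> x x"
    and x: "\<And>j. 0 \<le> x $ j" "\<beta> x x = 0" "0 < x $ j"
  shows "\<beta> x (axis j 1) = 0"
proof (rule ccontr)
  let ?e = "axis j 1 :: real ^ 'n"
  let ?B = "\<beta> x ?e" and ?C = "\<beta> ?e ?e"
  assume B: "?B \<noteq> 0"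
  have C: "0 \<le> ?C" by (rule cop) (simp add: axis_def)
  \<comment> \<open>The first bound keeps the perturbed point in the orthant; the second keeps the
    quadratic term below the linear one.\<close>
  define d where "d = min (x $ j) (\<bar>?B\<bar> / (?C + 1))"
  have d: "0 < d" "d \<le> x $ j" "d * ?C \<le> \<bar>?B\<bar>"
  proof -
    show "0 < d" using x(3) B C by (simp add: d_def)
    show "d \<le> x $ j" by (simp add: d_def)
    have "d * ?C \<le> \<bar>?B\<bar> / (?C + 1) * ?C" using C by (intro mult_right_mono) (auto simp: d_def)
    also have "\<dots> \<le> \<bar>?B\<bar>" using C by (simp add: field_simps)
    finally show "d * ?C \<le> \<bar>?B\<bar>" .
  qed
  define r where "r = - sgn ?B * d"
  have r: "\<bar>r\<bar> = d" using B d(1) by (simp add: r_def abs_mult)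
  have "0 \<le> (x + r *\<^sub>R ?e) $ k" for k
    using x(1)[of k] r d(2) by (cases "k = j") (auto simp: axis_def)
  then have "0 \<le> \<beta> (x + r *\<^sub>R ?e) (x + r *\<^sub>R ?e)" by (rule cop)
  also have "\<dots> = 2 * (r * ?B) + r\<^sup>2 * ?C"
    using sym[of ?e x] x(2)
    by (simp add: bilinear_ladd[OF bil] bilinear_radd[OF bil] bilinear_lmul[OF bil] bilinear_rmul[OF bil]
        power2_eq_square algebra_simps)
  also have "r * ?B = - (d * \<bar>?B\<bar>)" by (simp add: r_def abs_sgn)
  also have "r\<^sup>2 = d * d" using r by (metis power2_abs power2_eq_square)
  also have "2 * - (d * \<bar>?B\<bar>) + d * d * ?C = d * (d * ?C - 2 * \<bar>?B\<bar>)"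
    by (simp only: algebra_simps)
  finally have "0 \<le> d * (d * ?C - 2 * \<bar>?B\<bar>)" .
  then have "2 * \<bar>?B\<bar> \<le> d * ?C" using d(1) by (simp add: zero_le_mult_iff)
  then show False using d(3) B by simp
qed

text \<open>The differences D satisfy r (D(k-1) + D(k+1)) + (r + s) D(k) = 0. Where |D| is maximal
  this gives (r + s) M <= 2 r M, so M = 0 because r < s.\<close>

lemma periodic_recurrence_constant:
  fixes B :: "int \<Rightarrow> real"
  assumes per: "per m B" and m: "m > 0" and r: "0 < r" "r < s"
    and rec: "\<And>k. B k * s + B (k - 1) * r = B (k + 2) * r + B (k + 1) * s"
  shows "B k = B 0"
proof -
  define D where "D k = B k - B (k + 1)" for k
  have perD: "per m D" using per per_shift[OF per, of 1] by (simp add: per_def D_def)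
  have D: "r * (D (k - 1) + D (k + 1)) + (r + s) * D k = 0" for k
    using rec[of k] by (simp add: D_def algebra_simps)
  define M where "M = Max ((\<lambda>k. \<bar>D k\<bar>) ` {0..<m})"
  have le: "\<bar>D k\<bar> \<le> M" for k
  proof -
    have "\<bar>D (k mod m)\<bar> \<le> M" unfolding M_def using m by (intro Max_ge) auto
    then show ?thesis using per_mod[OF perD] by metis
  qed
  have "M \<in> (\<lambda>k. \<bar>D k\<bar>) ` {0..<m}" unfolding M_def using m by (intro Max_in) auto
  then obtain k1 where k1: "M = \<bar>D k1\<bar>" by blast
  have "(r + s) * M = \<bar>r * (D (k1 - 1) + D (k1 + 1))\<bar>"
  proof -
    have "r * (D (k1 - 1) + D (k1 + 1)) = - ((r + s) * D k1)" using D[of k1] by linarith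
    then show ?thesis using r unfolding k1 by (simp add: abs_mult)
  qed
  also have "\<dots> \<le> r * (\<bar>D (k1 - 1)\<bar> + \<bar>D (k1 + 1)\<bar>)"
    using r by (simp add: abs_mult)
  also have "\<dots> \<le> r * (M + M)" using le r by (intro mult_left_mono add_mono) auto
  finally have "(s - r) * M \<le> 0" by (simp add: algebra_simps)
  then have "M \<le> 0" using r by (simp add: mult_le_0_iff)
  then have "D k = 0" for k using le[of k] by simp
  then have step: "B (k + 1) = B k" for k by (simp add: D_def)
  show ?thesis
  proof (rule int_induct[of "\<lambda>k. B k = B 0" 0 k])
    show "B (i - 1) = B 0" if "B i = B 0" for i using step[of "i - 1"] that by simp
  qed (simp_all add: step)
qed

context base_form
begin

lemma bilinear_index_sum:
  assumes "bilinear \<beta>" "y $ z = 0"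
  shows "\<beta> x y = (\<Sum>i\<in>{0..<m}. y $ p i * \<beta> x (axis (p i) 1) :: real)"
proof -
  have "y = (\<Sum>j\<in>UNIV. y $ j *\<^sub>R axis j 1)"
    using basis_expansion[of y] by (simp add: scalar_mult_eq_scaleR)
  then have "\<beta> x y = \<beta> x (\<Sum>j\<in>UNIV. y $ j *\<^sub>R axis j 1)" by simp
  also have "\<dots> = (\<Sum>j\<in>UNIV. y $ j * \<beta> x (axis j 1))"
    using assms(1) by (simp add: bilinear_def linear_sum linear_cmul)
  finally show ?thesis using assms(2) by (simp add: sum_index)
qed

lemma axis_p: "axis (p k) (1::real) $ p i = (if i mod m = k mod m then 1 else 0)"
  by (auto simp: axis_def p_eq)

lemma axis_p_z: "axis (p k) (1::real) $ z = 0"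
  by (simp add: axis_def)

text \<open>The assumption \<open>van\<close> removes every position except the two where the shift
  of \<open>U\<close> vanishes.\<close>

lemma two_coefficients:
  assumes bil: "bilinear \<beta>" and van: "\<And>i. U (i - k) \<noteq> 0 \<Longrightarrow> \<beta> x (axis (p i) 1) = 0" and y: "y $ z = 0"
  shows "\<beta> x y = \<beta> x (axis (p (k - 1)) 1) * y $ p (k - 1) + \<beta> x (axis (p k) 1) * (y $ p k :: real)"
proof -
  let ?f = "axis (p (k - 1)) 1 :: real ^ 'a" and ?e = "axis (p k) 1 :: real ^ 'a"
  let ?y = "y - y $ p (k - 1) *\<^sub>R ?f - y $ p k *\<^sub>R ?e"
  have ne: "(k - 1) mod m \<noteq> k mod m"
  proof
    assume "(k - 1) mod m = k mod m"
    then have "m dvd 1" by (simp add: mod_eq_dvd_iff)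
    then show False using m5 by simp
  qed
  have "\<beta> x ?y = (\<Sum>i\<in>{0..<m}. ?y $ p i * \<beta> x (axis (p i) 1))"
    by (rule bilinear_index_sum[OF bil]) (simp add: y axis_p_z)
  also have "\<dots> = 0"
  proof (rule sum.neutral, intro ballI)
    fix i
    show "?y $ p i * \<beta> x (axis (p i) 1) = 0"
    proof (cases "U (i - k) = 0")
      case True
      then have "(i - k) mod m = 0 \<or> (i - k) mod m = m - 1"
        using mod_cases[of "i - k"] U_nonzero_iff[of "i - k"] by auto
      then have "i mod m = k mod m \<or> i mod m = (k - 1) mod m"
      proof
        assume "(i - k) mod m = m - 1"
        then have "(i - (k - 1)) mod m = 0"
          by (metis add.commute diff_add_cancel diff_diff_eq2 mod_add_left_eq mod_self)
        then show ?thesis by (metis mod_eq_dvd_iff dvd_eq_mod_eq_0)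
      qed (metis mod_eq_dvd_iff dvd_eq_mod_eq_0)
      then show ?thesis
      proof
        assume h: "i mod m = k mod m"
        then have "p i = p k" using p_eq by simp
        then show ?thesis using ne by (simp add: axis_p)
      next
        assume h: "i mod m = (k - 1) mod m"
        then have "p i = p (k - 1)" using p_eq by simp
        then show ?thesis using ne by (simp add: axis_p)
      qed
    qed (simp add: van)
  qed
  finally show ?thesis
    unfolding bilinear_rsub[OF bil] bilinear_rmul[OF bil] by (simp add: mult.commute)
qed

lemma U_minus2: "U (-2) = U 1" and U_minus3: "U (-3) = U 2"
  using U_reflect[of 1] U_reflect[of 2] by simp_all

lemma g_u: "y $ z = 0 \<Longrightarrow> g (u k) y = c * (y $ p (k - 1) + y $ p k)"
  unfolding g_def merge_last_u b_shift_U[OF per_merge_last] by (simp add: merge_last_def)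

text \<open>Pairing with \<open>u k\<close> is c times the sum of two adjacent coordinates. On an
  odd cycle these adjacent sums span everything, so the \<open>u k\<close> span a space of full
  dimension.\<close>

lemma span_u: "{x. x $ z = 0} \<subseteq> span (u ` {0..<m})"
proof -
  let ?V = "{x :: real ^ 'a. x $ z = 0}" and ?S = "u ` {0..<m}"
  define T where "T x = (\<chi> j. if j = z then 0 else g x (axis j 1))" for x
  have lin: "linear T"
    by (rule linearI)
      (auto simp: T_def vec_eq_iff bilinear_ladd[OF bilinear_g] bilinear_lmul[OF bilinear_g])
  let ?e = "\<lambda>k. axis (p k) 1 :: real ^ 'a"
  let ?M = "span (T ` ?S)"
  have u_mod: "u (k mod m) = u k" for k
    by (rule vec_eqI) (auto simp: u_z u_p mod_diff_right_eq intro: per_cong[OF per_U])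
  have Tu: "T (u k) = c *\<^sub>R (?e (k - 1) + ?e k)" for k
  proof (rule vec_eqI)
    fix i
    show "T (u k) $ p i = (c *\<^sub>R (?e (k - 1) + ?e k)) $ p i"
      by (auto simp: T_def g_u axis_p_z axis_p)
  qed (simp add: T_def axis_p_z)
  have pair: "?e (k - 1) + ?e k \<in> ?M" for k
  proof -
    have "T (u k) \<in> ?M"
      unfolding u_mod[of k, symmetric] using m_pos by (intro span_base imageI) simp
    then have "inverse c *\<^sub>R T (u k) \<in> ?M" by (rule span_mul)
    then show ?thesis using c_pos by (simp add: Tu)
  qed
  \<comment> \<open>Alternating sums of adjacent pairs; once around the cycle, as \<open>m\<close>
    is odd, they give twice a unit vector.\<close>
  have alt: "?e k - (-1) ^ j *\<^sub>R ?e (k + int j) \<in> ?M" for k j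
  proof (induction j)
    case (Suc j)
    have "?e k - (-1) ^ j *\<^sub>R ?e (k + int j) + (-1) ^ j *\<^sub>R (?e (k + int j + 1 - 1) + ?e (k + int j + 1)) \<in> ?M"
      by (intro span_add span_mul Suc pair)
    then show ?case by (simp add: algebra_simps)
  qed (simp add: span_zero)
  have e: "?e k \<in> ?M" for k
  proof -
    have "odd (nat m)" using odd_m m_pos by (simp add: even_nat_iff)
    then have "?e k + ?e (k + m) \<in> ?M" using alt[of k "nat m"] m_pos by simp
    moreover have "p (k + m) = p k" by (simp add: p_eq)
    ultimately have "(1/2) *\<^sub>R (?e k + ?e k) \<in> ?M" by (metis span_mul)
    then show ?thesis by (simp add: scaleR_add_right[symmetric] flip: scaleR_2)
  qed
  have "?V \<subseteq> ?M"
  proof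
    fix x :: "real ^ 'a" assume x: "x \<in> ?V"
    have "x = (\<Sum>j\<in>UNIV. x $ j *\<^sub>R axis j 1)"
      using basis_expansion[of x] by (simp add: scalar_mult_eq_scaleR)
    also have "\<dots> = (\<Sum>i\<in>{0..<m}. x $ p i *\<^sub>R ?e i)" using x by (simp add: sum_index)
    also have "\<dots> \<in> ?M" by (intro span_sum span_mul e)
    finally show "x \<in> ?M" .
  qed
  \<comment> \<open>A linear map cannot raise the dimension, so the spanning of the images carries
    back to the \<open>u k\<close>.\<close>
  then have "dim ?V \<le> dim (T ` ?S)" by (rule dim_mono)
  also have "\<dots> \<le> dim ?S" by (rule dim_image_le[OF lin])
  finally have "dim ?V \<le> dim (span ?S)" by simp
  moreover have subV: "subspace ?V" by (auto simp: subspace_def)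
  moreover have "span ?S \<subseteq> ?V" by (rule span_minimal[OF _ subV]) (auto simp: u_z)
  ultimately have "span ?S = ?V" by (intro subspace_dim_equal subspace_span) auto
  then show ?thesis by simp
qed

text \<open>Stationarity at the \<open>u k\<close> leaves two unknowns per k, which symmetry and the
  recurrence reduce to one constant. Stationarity at the zeros s u_k + q puts \<open>q\<close> into
  the kernel of \<open>\<beta>\<close>, as it is for \<open>g\<close>.\<close>

lemma proportional:
  assumes bil: "bilinear \<beta>" and sym: "\<And>x y. \<beta> x y = \<beta> y x"
    and cop: "\<And>x. (\<And>j. 0 \<le> x $ j) \<Longrightarrow> 0 \<le> \<beta> x x"
    and van: "\<And>x. (\<And>j. 0 \<le> x $ j) \<Longrightarrow> g x x = 0 \<Longrightarrow> \<beta> x x = 0"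
  shows "\<exists>l. \<forall>x. \<beta> x x = l * (g x x :: real)"
proof -
  have stat: "\<beta> x (axis j 1) = 0" if "\<And>j. 0 \<le> x $ j" "\<beta> x x = 0" "0 < x $ j" for x j
    using copositive_zero_stationary[OF bil sym, of x j] cop that by blast
  let ?e = "\<lambda>k. axis (p k) 1 :: real ^ 'a"
  have gu: "g (u k) (u k) = 0" for k by (simp add: g_def merge_last_u b_shift_U_null)
  have van_u: "\<beta> (u k) (?e i) = 0" if "U (i - k) \<noteq> 0" for k i
    by (rule stat[OF u_nonneg van[OF u_nonneg gu]])
      (use that U_nonneg[of "i - k"] in \<open>simp add: u_p\<close>)
  define B where "B k = \<beta> (u k) (?e (k - 1))" for k
  define B' where "B' k = \<beta> (u k) (?e k)" for k
  have exp: "\<beta> (u k) y = B k * y $ p (k - 1) + B' k * y $ p k" if "y $ z = 0" for k y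
    unfolding B_def B'_def by (rule two_coefficients[OF bil van_u that])
  \<comment> \<open>Symmetry for neighbouring shifts identifies the two families of
    coefficients.\<close>
  have B': "B' (k + 1) = B k" for k
    using sym[of "u k" "u (k + 1)"] U_1
    by (simp add: exp[OF u_z] u_p U_0 U_m1 U_minus2)
  \<comment> \<open>Symmetry for shifts at distance two gives the recurrence; the values of
    \<open>U\<close> at -2 and -3 are \<open>U 1\<close> and \<open>U 2\<close> by
    reflection.\<close>
  have rec: "B k * U 2 + B (k - 1) * U 1 = B (k + 2) * U 1 + B (k + 1) * U 2" for k
  proof -
    have "B' (k + 2) = B (k + 1)" using B'[of "k + 1"] by (metis add.assoc one_add_one)
    then show ?thesis using sym[of "u k" "u (k + 2)"] B'[of "k - 1"]
      by (simp add: exp[OF u_z] u_p U_0 U_m1 U_minus2 U_minus3)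
  qed
  have "per m B"
  proof -
    have "u (k + m) = u k" for k
    proof (rule vec_eqI)
      show "u (k + m) $ p i = u k $ p i" for i
        using per_U[unfolded per_def, rule_format, of "i - (k + m)"] by (simp add: u_p)
    qed (simp add: u_z)
    moreover have "p (k + m - 1) = p (k - 1)" for k by (simp add: p_eq mod_eq_dvd_iff)
    ultimately show ?thesis by (simp add: per_def B_def)
  qed
  from periodic_recurrence_constant[OF this m_pos U_1 U_12 rec] have Bc: "B k = B 0" for k .
  then have Bc': "B' k = B 0" for k using B'[of "k - 1"] by simp
  define l where "l = B 0 / c"
  have "\<beta> x y - l * g x y = 0" if x: "x $ z = 0" and y: "y $ z = 0" for x y
  proof -
    have lin: "linear (\<lambda>x. \<beta> x y - l * g x y)"
      by (rule linearI) (simp_all add: bilinear_ladd[OF bil] bilinear_ladd[OF bilinear_g]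
          bilinear_lmul[OF bil] bilinear_lmul[OF bilinear_g] algebra_simps)
    have "x \<in> span (u ` {0..<m})" using span_u x by auto
    then show ?thesis
    proof (rule linear_eq_0_on_span[OF lin, rotated])
      fix x assume "x \<in> u ` {0..<m}"
      then obtain k where "x = u k" by blast
      then show "\<beta> x y - l * g x y = 0"
        using c_pos by (simp add: exp[OF y] g_u[OF y] Bc[of k] Bc'[of k] l_def algebra_simps)
    qed
  qed
  then have base: "\<beta> x x = l * g x x" if "x $ z = 0" for x using that by fastforce
  obtain s0 where s0: "\<And>k s. k \<in> {1..3} \<Longrightarrow> s \<ge> s0 \<Longrightarrow> 0 < s \<and> (\<forall>j. 0 \<le> (s *\<^sub>R u k + q) $ j) \<and>
     g (s *\<^sub>R u k + q) (s *\<^sub>R u k + q) = 0 \<and> (\<forall>i. U (i - k) \<noteq> 0 \<longrightarrow> 0 < (s *\<^sub>R u k + q) $ p i)"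
    by (rule large_zero) blast
  have stat_q: "\<beta> (s *\<^sub>R u k + q) (axis j 1) = 0"
    if "k \<in> {1..3}" "s \<ge> s0" "0 < (s *\<^sub>R u k + q) $ j" for s k j
    using s0[OF that(1,2)] that(3) by (intro stat van) auto
  \<comment> \<open>The shift by 1 vanishes only at residues 0 and 1, where the shift by 3 is
    positive. So each position is positive in one of the two zeros.\<close>
  have qp: "\<beta> q (?e i) = 0" for i
  proof -
    have "i mod m \<in> {0, 1} \<Longrightarrow> U (i - 3) \<noteq> 0"
    proof -
      assume "i mod m \<in> {0, 1}"
      then have "(i - 3) mod m = m - 3 \<or> (i - 3) mod m = m - 2"
        using m5 mod_diff_left_eq[of i m 3] by (auto simp: mod_pos_neg_trivial zmod_minus1 zmod_trivial_iff)
          (smt (verit) mod_add_self2 mod_pos_pos_trivial)+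
      then show ?thesis using m5 by (auto simp: U_nonzero_iff)
    qed
    moreover have "i mod m \<notin> {0, 1} \<Longrightarrow> U (i - 1) \<noteq> 0"
    proof -
      assume "i mod m \<notin> {0, 1}"
      moreover have "0 \<le> i mod m" "i mod m < m" using m_pos by auto
      ultimately have "(i - 1) mod m = i mod m - 1"
        using mod_diff_left_eq[of i m 1] by (auto simp: mod_pos_pos_trivial)
      then show ?thesis using \<open>i mod m \<notin> {0, 1}\<close> \<open>0 \<le> i mod m\<close> \<open>i mod m < m\<close> by (auto simp: U_nonzero_iff)
    qed
    ultimately obtain k :: int where k: "k \<in> {1..3}" "U (i - k) \<noteq> 0" by force
    have "\<beta> (s0 *\<^sub>R u k + q) (?e i) = 0"
      by (rule stat_q[OF k(1)]) (use s0[OF k(1), of s0] k(2) in auto)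
    then show ?thesis
      by (simp add: bilinear_ladd[OF bil] bilinear_lmul[OF bil] van_u[OF k(2)])
  qed
  have "\<beta> (s *\<^sub>R u 1 + q) (axis z 1) = 0" if "s \<ge> s0" for s
    by (rule stat_q[OF _ that]) (simp_all add: u_z q_z)
  then have e: "s * \<beta> (u 1) (axis z 1) + \<beta> q (axis z 1) = 0" if "s \<ge> s0" for s
    using that by (simp add: bilinear_ladd[OF bil] bilinear_lmul[OF bil])
  \<comment> \<open>Two values of s separate the coefficient of s from the constant term.\<close>
  from e[of s0] e[of "s0 + 1"] have "\<beta> (u 1) (axis z 1) = 0" by (simp add: algebra_simps)
  with e[of s0] have "\<beta> q (axis z 1) = 0" by simp
  with qp have qa: "\<beta> q (axis j 1) = 0" for j by (cases j rule: index_cases) auto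
  have q0: "\<beta> q y = 0" for y
  proof -
    have "y = (\<Sum>j\<in>UNIV. y $ j *\<^sub>R axis j 1)"
      using basis_expansion[of y] by (simp add: scalar_mult_eq_scaleR)
    then have "\<beta> q y = \<beta> q (\<Sum>j\<in>UNIV. y $ j *\<^sub>R axis j 1)" by simp
    also have "\<dots> = 0" using bil by (simp add: bilinear_def linear_sum linear_cmul qa)
    finally show ?thesis .
  qed
  have "\<beta> x x = l * g x x" for x
  proof -
    let ?y = "x - x $ z *\<^sub>R q"
    have x: "x = ?y + x $ z *\<^sub>R q" by simp
    have "\<beta> x x = \<beta> ?y ?y"
      using sym[of _ q] by (subst x, subst (2) x)
        (simp add: bilinear_ladd[OF bil] bilinear_radd[OF bil] bilinear_lmul[OF bil] bilinear_rmul[OF bil] q0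
          bilinear_lsub[OF bil] bilinear_rsub[OF bil])
    moreover have "merge_last ?y = merge_last x" by (auto simp: merge_last_def q_p q_z)
    ultimately show ?thesis using base[of ?y] by (simp add: q_z g_def)
  qed
  then show ?thesis by blast
qed

end

section \<open>Maximal faces and the lower bound\<close>

lemma convex_cone_zero: "convex_cone K \<Longrightarrow> 0 \<in> K"
  and convex_cone_plus: "convex_cone K \<Longrightarrow> x \<in> K \<Longrightarrow> y \<in> K \<Longrightarrow> x + y \<in> K"
  and convex_cone_scale: "convex_cone K \<Longrightarrow> x \<in> K \<Longrightarrow> 0 \<le> r \<Longrightarrow> r *\<^sub>R x \<in> K"
  by (simp_all add: convex_cone_iff)

text \<open>A nonzero element x of the face is the midpoint of 0 and 2 x.\<close>

lemma face_of_cone_zero: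
  assumes K: "convex_cone K" and F: "F face_of K" "F \<noteq> {}"
  shows "0 \<in> F"
proof -
  obtain x where x: "x \<in> F" using F(2) by blast
  then have xK: "x \<in> K" using F(1) face_of_imp_subset by blast
  show ?thesis
  proof (cases "x = 0")
    case False
    have "x \<in> open_segment 0 (2 *\<^sub>R x)"
      unfolding in_segment using False by (auto intro!: exI[of _ "1/2"])
    then show ?thesis
      using face_ofD[OF F(1) _ convex_cone_zero[OF K] convex_cone_scale[OF K xK] x] by simp
  qed (use x in simp)
qed

lemma face_of_cone_scale:
  assumes K: "convex_cone K" and F: "F face_of K" and x: "x \<in> F" and r: "0 \<le> r"
  shows "r *\<^sub>R x \<in> F"
proof -
  have xK: "x \<in> K" using F x face_of_imp_subset by blast
  have diff_energy: "0 \<in> F" using face_of_cone_zero[OF K F] x by blast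
  consider "r \<le> 1" | "x = 0" | "r > 1" "x \<noteq> 0" by linarith
  then show ?thesis
  proof cases
    case 1
    have "(1 - r) *\<^sub>R 0 + r *\<^sub>R x \<in> F"
      using face_of_imp_convex[OF F] diff_energy x r 1 by (intro convexD) auto
    then show ?thesis by simp
  next
    case 3
    have "x \<in> open_segment 0 (r *\<^sub>R x)"
      unfolding in_segment using 3 by (auto intro!: exI[of _ "1/r"])
    then show ?thesis
      using face_ofD[OF F _ convex_cone_zero[OF K] convex_cone_scale[OF K xK r] x] by simp
  qed (use diff_energy in simp)
qed

text \<open>The sum a + b is the midpoint of 2 a and 2 b; for a = b this segment degenerates and
  scaling is used instead.\<close>

lemma face_of_cone_summand:
  assumes K: "convex_cone K" and F: "F face_of K" and ab: "a \<in> K" "b \<in> K" "a + b \<in> F"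
  shows "a \<in> F"
proof (cases "a = b")
  case True
  then show ?thesis using face_of_cone_scale[OF K F ab(3), of "1/2"] by (simp flip: scaleR_2)
next
  case False
  have "a + b \<in> open_segment (2 *\<^sub>R a) (2 *\<^sub>R b)"
    unfolding in_segment using False by (auto intro!: exI[of _ "1/2"])
  then have "2 *\<^sub>R a \<in> F"
    using face_ofD[OF F _ convex_cone_scale[OF K ab(1)] convex_cone_scale[OF K ab(2)] ab(3)] by simp
  from face_of_cone_scale[OF K F this, of "1/2"] show ?thesis by simp
qed

text \<open>A larger proper face lies in a supporting hyperplane of the cone. Its normal
  \<open>B\<close> is nonnegative on the cone and vanishes on the given face, so by
  \<open>uniq\<close> it exposes the same face.\<close>

lemma maximal_face_criterion:
  fixes K :: "'a::euclidean_space set"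
  assumes K: "convex_cone K"
    and pos: "\<And>X. X \<in> K \<Longrightarrow> 0 \<le> A \<bullet> X"
    and proper: "X0 \<in> K" "A \<bullet> X0 \<noteq> 0"
    and uniq: "\<And>B. (\<And>X. X \<in> K \<Longrightarrow> 0 \<le> B \<bullet> X) \<Longrightarrow> (\<And>X. X \<in> K \<Longrightarrow> A \<bullet> X = 0 \<Longrightarrow> B \<bullet> X = 0)
        \<Longrightarrow> \<exists>l. \<forall>X\<in>K. B \<bullet> X = l * (A \<bullet> X)"
  shows "maximal_face K (K \<inter> {X. A \<bullet> X = 0})"
proof -
  let ?F = "K \<inter> {X. A \<bullet> X = 0}"
  have cK: "convex K" using K by (simp add: convex_cone_def)
  have face: "?F face_of K"
    using face_of_Int_supporting_hyperplane_ge[OF cK, of 0 A] pos by simp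
  have ne: "0 \<in> ?F" using convex_cone_zero[OF K] by simp
  have False if G: "G face_of K" "G \<noteq> {}" "G \<noteq> K" "?F \<subset> G" for G
  proof -
    have "rel_interior G \<noteq> {}" using G rel_interior_eq_empty face_of_imp_convex by blast
    then obtain x where x: "x \<in> rel_interior G" by blast
    then have xG: "x \<in> G" using rel_interior_subset by blast
    then have xK: "x \<in> K" using G(1) face_of_imp_subset by blast
    have "x \<notin> rel_interior K" using face_of_disjoint_rel_interior[OF G(1,3)] xG by blast
    then obtain B where B: "\<And>y. y \<in> K \<Longrightarrow> B \<bullet> x \<le> B \<bullet> y" "\<And>y. y \<in> rel_interior K \<Longrightarrow> B \<bullet> x < B \<bullet> y"
      using supporting_hyperplane_rel_boundary[OF cK xK] by metis
    \<comment> \<open>The cone contains 0 and 2 x, so the supporting hyperplane at \<open>x\<close>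
      passes through the origin.\<close>
    have "B \<bullet> x \<le> 0" using B(1)[OF convex_cone_zero[OF K]] by simp
    moreover have "B \<bullet> x \<le> B \<bullet> (2 *\<^sub>R x)" using B(1)[OF convex_cone_scale[OF K xK, of 2]] by simp
    ultimately have Bx: "B \<bullet> x = 0" by simp
    \<comment> \<open>A face that meets the relative interior of \<open>G\<close> contains
      \<open>G\<close>.\<close>
    have "K \<inter> {y. B \<bullet> y = 0} face_of K"
      using face_of_Int_supporting_hyperplane_ge[OF cK, of 0 B] B(1) Bx by simp
    from subset_of_face_of[OF this face_of_imp_subset[OF G(1)]]
    have BG: "G \<subseteq> K \<inter> {y. B \<bullet> y = 0}" using x xK Bx by blast
    have "\<exists>l. \<forall>X\<in>K. B \<bullet> X = l * (A \<bullet> X)"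
    proof (rule uniq)
      show "0 \<le> B \<bullet> X" if "X \<in> K" for X using B(1)[OF that] Bx by simp
      show "B \<bullet> X = 0" if "X \<in> K" "A \<bullet> X = 0" for X
      proof -
        have "X \<in> G" using that G(4) by blast
        then show ?thesis using BG by blast
      qed
    qed
    then obtain l where l: "\<And>X. X \<in> K \<Longrightarrow> B \<bullet> X = l * (A \<bullet> X)" by blast
    have "rel_interior K \<noteq> {}" using cK xK rel_interior_eq_empty by blast
    then obtain y where "y \<in> rel_interior K" by blast
    then have "0 < B \<bullet> y" "y \<in> K" using B(2) Bx rel_interior_subset by auto
    then have "l \<noteq> 0" using l by auto
    have "G \<subseteq> ?F"
    proof
      fix X assume "X \<in> G"
      then have "X \<in> K" "B \<bullet> X = 0" using BG by auto
      then show "X \<in> ?F" using l[of X] \<open>l \<noteq> 0\<close> by simp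
    qed
    then show False using G(4) by blast
  qed
  moreover have "?F \<noteq> K" using proper by blast
  ultimately show ?thesis unfolding maximal_face_def using face ne by blast
qed

section \<open>Outer products and the generators of faces\<close>

lemma convex_cone_completely_positive: "convex_cone completely_positive"
  unfolding completely_positive_def by (rule convex_cone_convex_cone_hull)

lemma outer_completely_positive: "\<forall>i. 0 \<le> x $ i \<Longrightarrow> outer x \<in> completely_positive"
  unfolding completely_positive_def by (rule hull_inc) blast

lemma completely_positive_sum:
  assumes "X \<in> completely_positive"
  shows "\<exists>(m::nat) c x. X = (\<Sum>k<m. c k *\<^sub>R outer (x k)) \<and>
    (\<forall>k<m. 0 \<le> c k) \<and> (\<forall>k<m. \<forall>i. 0 \<le> x k $ i)"
  using assms unfolding completely_positive_conic_combinations by blast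

lemma inner_outer: "(A :: real ^ 'n::finite ^ 'n) \<bullet> outer x = x \<bullet> (A *v x)"
  by (simp add: inner_vec_def outer_nth matrix_vector_mult_def sum_distrib_left mult.commute mult.left_commute)

lemma outer_mult_vec: "outer x *v y = (x \<bullet> y) *\<^sub>R x"
  by (simp add: vec_eq_iff outer_nth matrix_vector_mult_def inner_vec_def sum_distrib_left mult.commute mult.left_commute)

lemma inner_outer_outer: "outer v \<bullet> outer x = (v \<bullet> x)\<^sup>2"
  by (simp add: inner_outer outer_mult_vec power2_eq_square inner_commute)

definition face_generators :: "(real ^ 'n ^ 'n) set \<Rightarrow> (real ^ 'n) set" where
  "face_generators F = {x. (\<forall>i. 0 \<le> x $ i) \<and> outer x \<in> F}"

text \<open>The remaining terms again sum to an element of the cone, so the face property applies to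
  each single term, which is then rescaled.\<close>

lemma face_terms:
  assumes F: "F face_of completely_positive"
    and X: "(\<Sum>k<(m::nat). c k *\<^sub>R outer (x k)) \<in> F" "\<And>k. k < m \<Longrightarrow> 0 \<le> c k" "\<And>k i. k < m \<Longrightarrow> 0 \<le> x k $ i"
    and k: "k < m" "c k \<noteq> 0"
  shows "x k \<in> face_generators F"
proof -
  note K = convex_cone_completely_positive
  have cp: "c k *\<^sub>R outer (x k) \<in> completely_positive" if "k < m" for k
    using convex_cone_scale[OF K outer_completely_positive] X that by blast
  have rest: "(\<Sum>k\<in>S. c k *\<^sub>R outer (x k)) \<in> completely_positive" if "finite S" "S \<subseteq> {..<m}" for S
    using that by (induction S rule: finite_induct) (auto intro: convex_cone_zero[OF K] convex_cone_plus[OF K] cp)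
  have "c k *\<^sub>R outer (x k) + (\<Sum>k\<in>{..<m} - {k}. c k *\<^sub>R outer (x k)) \<in> F"
    using X(1) k(1) by (simp add: sum.remove[of "{..<m}" k])
  from face_of_cone_summand[OF K F cp[OF k(1)] rest this]
  have "c k *\<^sub>R outer (x k) \<in> F" by simp
  from face_of_cone_scale[OF K F this, of "1 / c k"] have "outer (x k) \<in> F"
    using k X(2)[OF k(1)] by simp
  then show ?thesis using X(3) k(1) by (simp add: face_generators_def)
qed

lemma outer_combination_mult_vec:
  "(\<Sum>b\<in>B. c b *\<^sub>R outer b) *v y = (\<Sum>b\<in>B. (c b * (b \<bullet> y)) *\<^sub>R b)"
  by (induction B rule: infinite_finite_induct)
    (simp_all add: matrix_vector_mult_add_rdistrib scaleR_matrix_vector_assoc[symmetric] outer_mult_vec)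

text \<open>Applying the matrix relation to a vector \<open>y\<close> gives a linear relation in
  \<open>B\<close>, so each coefficient vanishes for every \<open>y\<close>. The coefficient of
  \<open>b1\<close> forces d = 0, since \<open>b1\<close> and \<open>b2\<close> are independent;
  then y = b gives c b = 0.\<close>

lemma independent_outer_coeff:
  assumes B: "independent B" "finite B" and b12: "b1 \<in> B" "b2 \<in> B" "b1 \<noteq> b2"
    and s: "(\<Sum>b\<in>B. c b *\<^sub>R outer b) + d *\<^sub>R outer (b1 + b2) = 0"
  shows "d = 0 \<and> (\<forall>b\<in>B. c b = 0)"
proof -
  define r where "r y b = c b * (b \<bullet> y) + (if b \<in> {b1, b2} then d * ((b1 + b2) \<bullet> y) else 0)" for y b
  have r0: "r y b = 0" if "b \<in> B" for y b
  proof -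
    have "(\<Sum>b\<in>B. (if b \<in> {b1, b2} then d * ((b1 + b2) \<bullet> y) else 0) *\<^sub>R b)
        = (\<Sum>b\<in>{b1, b2}. (d * ((b1 + b2) \<bullet> y)) *\<^sub>R b)"
      using B(2) b12 by (intro sum.mono_neutral_cong_right) auto
    also have "\<dots> = (d * ((b1 + b2) \<bullet> y)) *\<^sub>R (b1 + b2)"
      using b12 by (simp add: scaleR_add_right)
    finally have "(\<Sum>b\<in>B. r y b *\<^sub>R b) = ((\<Sum>b\<in>B. c b *\<^sub>R outer b) + d *\<^sub>R outer (b1 + b2)) *v y"
      by (simp add: r_def scaleR_add_left sum.distrib matrix_vector_mult_add_rdistrib
        outer_combination_mult_vec scaleR_matrix_vector_assoc[symmetric] outer_mult_vec)
    then have "(\<Sum>b\<in>B. r y b *\<^sub>R b) = 0" by (simp add: s)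
    then show ?thesis using B that by (auto simp: independent_explicit)
  qed
  have nz: "b \<noteq> 0" if "b \<in> B" for b using B(1) that dependent_zero by blast
  have "d = 0"
  proof (rule ccontr)
    assume d: "d \<noteq> 0"
    have "((c b1 + d) *\<^sub>R b1 + d *\<^sub>R b2) \<bullet> y = 0" for y
      using r0[OF b12(1), of y] by (simp add: r_def algebra_simps)
    then have "(c b1 + d) *\<^sub>R b1 + d *\<^sub>R b2 = 0" using inner_eq_zero_iff by blast
    then have "b2 = (- (c b1 + d) / d) *\<^sub>R b1"
      using d by (metis (no_types, lifting) add.inverse_inverse add_eq_0_iff divide_inverse_commute
        eq_vector_fraction_iff minus_divide_left scaleR_minus_left scaleR_right_imp_eq)
    then have "b2 \<in> span {b1}" by (metis span_base span_mul singletonI)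
    moreover have "span {b1} \<subseteq> span (B - {b2})" using b12 by (intro span_mono) auto
    ultimately show False using B(1) b12(2) by (auto simp: dependent_def)
  qed
  moreover have "c b = 0" if "b \<in> B" for b
    using r0[OF that, of b] nz[OF that] \<open>d = 0\<close> by (simp add: r_def split: if_splits)
  ultimately show ?thesis by blast
qed

lemma card_le_dim_outer:
  fixes B :: "(real ^ 'n::finite) set"
  assumes B: "independent B" and BU: "outer ` B \<subseteq> F" and b12: "b1 \<in> B" "b2 \<in> B" "b1 \<noteq> b2"
  shows "card B \<le> dim F" "outer (b1 + b2) \<in> F \<Longrightarrow> card B + 1 \<le> dim F"
proof -
  have fin: "finite B" using B independent_bound by blast
  have zero: "d = 0 \<and> (\<forall>b\<in>B. c b = 0)"
    if "(\<Sum>b\<in>B. c b *\<^sub>R outer b) + d *\<^sub>R outer (b1 + b2) = 0" for c d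
    using independent_outer_coeff[OF B fin b12 that] by blast
  have inj: "inj_on outer B"
  proof (rule inj_onI)
    fix a b assume ab: "a \<in> B" "b \<in> B" "outer a = outer b"
    show "a = b"
    proof (rule ccontr)
      assume "a \<noteq> b"
      let ?c = "\<lambda>x. if x = a then 1 else if x = b then -1 else 0 :: real"
      have "(\<Sum>x\<in>B. ?c x *\<^sub>R outer x) = (\<Sum>x\<in>{a, b}. ?c x *\<^sub>R outer x)"
        using fin ab by (intro sum.mono_neutral_right) auto
      also have "\<dots> = 0" using ab \<open>a \<noteq> b\<close> by simp
      finally have "\<forall>x\<in>B. ?c x = 0" using zero[of ?c 0] by simp
      from bspec[OF this ab(1)] show False by simp
    qed
  qed
  have notin: "outer (b1 + b2) \<notin> outer ` B"
  proof
    assume "outer (b1 + b2) \<in> outer ` B"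
    then obtain b where b: "b \<in> B" "outer (b1 + b2) = outer b" by blast
    have "(\<Sum>x\<in>B. (if x = b then 1 else 0) *\<^sub>R outer x) = outer b"
      using b fin by (simp add: if_distrib[of "\<lambda>r. r *\<^sub>R _"] cong: if_cong)
    then show False using zero[of "\<lambda>x. if x = b then 1 else 0" "-1"] b by simp
  qed
  have ind1: "independent (insert (outer (b1 + b2)) (outer ` B))"
  proof -
    have "\<forall>v\<in>insert (outer (b1 + b2)) (outer ` B). f v = 0"
      if "(\<Sum>v\<in>insert (outer (b1 + b2)) (outer ` B). f v *\<^sub>R v) = 0" for f
    proof -
      have "(\<Sum>b\<in>B. f (outer b) *\<^sub>R outer b) + f (outer (b1 + b2)) *\<^sub>R outer (b1 + b2) = 0"
        using that fin notin inj by (simp add: sum.reindex add.commute)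
      from zero[OF this] show ?thesis by blast
    qed
    then show ?thesis using fin by (auto simp: independent_explicit)
  qed
  have "independent (outer ` B)" using ind1 independent_mono by blast
  from independent_card_le_dim[OF BU this] show "card B \<le> dim F"
    by (simp add: card_image[OF inj])
  show "card B + 1 \<le> dim F" if "outer (b1 + b2) \<in> F"
  proof -
    have "insert (outer (b1 + b2)) (outer ` B) \<subseteq> F" using that BU by simp
    from independent_card_le_dim[OF this ind1] show ?thesis
      using notin fin by (simp add: card_image[OF inj])
  qed
qed

section \<open>Faces exposed by rank-one matrices and the lower bound\<close>

definition hyperplane_face :: "real ^ 'n \<Rightarrow> (real ^ 'n ^ 'n) set" where
  "hyperplane_face v = completely_positive \<inter> {X. outer v \<bullet> X = 0}"

lemma outer_inner_nonneg:
  assumes "X \<in> completely_positive" shows "0 \<le> outer v \<bullet> X"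
proof -
  obtain m :: nat and c x where X: "X = (\<Sum>k<m. c k *\<^sub>R outer (x k))" "\<forall>k<m. 0 \<le> c k"
    using completely_positive_sum[OF assms] by blast
  show ?thesis unfolding X(1) inner_sum_right
    by (intro sum_nonneg) (use X(2) in \<open>simp add: inner_outer_outer\<close>)
qed

lemma hyperplane_face_proper:
  fixes v :: "real ^ 'n::finite"
  assumes "v \<noteq> 0"
  shows "hyperplane_face v face_of completely_positive" "hyperplane_face v \<noteq> {}" "hyperplane_face v \<noteq> completely_positive"
proof -
  have c: "convex (completely_positive :: (real ^ 'n ^ 'n) set)"
    by (rule conjunct1[OF conjunct2[OF convex_cone_completely_positive[unfolded convex_cone_def]]])
  show "hyperplane_face v face_of completely_positive"
    using face_of_Int_supporting_hyperplane_ge[OF c, of 0 "outer v"] outer_inner_nonneg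
    unfolding hyperplane_face_def by blast
  show "hyperplane_face v \<noteq> {}"
    using convex_cone_zero[OF convex_cone_completely_positive] by (auto simp: hyperplane_face_def)
  obtain j where "v $ j \<noteq> 0" using assms by (auto simp: vec_eq_iff)
  then have "outer v \<bullet> outer (axis j 1) \<noteq> 0" by (simp add: inner_outer_outer inner_axis)
  moreover have "outer (axis j 1) \<in> completely_positive"
    by (rule outer_completely_positive) (simp add: axis_def)
  ultimately show "hyperplane_face v \<noteq> completely_positive" by (auto simp: hyperplane_face_def)
qed

lemma face_generators_hyperplane_face: "face_generators (hyperplane_face v) = {x. (\<forall>i. 0 \<le> x $ i) \<and> v \<bullet> x = 0}"
  using outer_completely_positive by (auto simp: face_generators_def hyperplane_face_def inner_outer_outer)

lemma face_subset_hyperplane_face: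
  assumes F: "F face_of completely_positive" and v: "\<And>x. x \<in> face_generators F \<Longrightarrow> v \<bullet> x = 0"
  shows "F \<subseteq> hyperplane_face v"
proof
  fix X assume X: "X \<in> F"
  then have XK: "X \<in> completely_positive" using F face_of_imp_subset by blast
  then obtain m :: nat and c x where e: "X = (\<Sum>k<m. c k *\<^sub>R outer (x k))"
    "\<forall>k<m. 0 \<le> c k" "\<forall>k<m. \<forall>i. 0 \<le> x k $ i" using completely_positive_sum by blast
  have "c k * (v \<bullet> x k)\<^sup>2 = 0" if "k < m" for k
    using face_terms[OF F X[unfolded e(1)] _ _ that] e(2,3) v by (cases "c k = 0") auto
  then have "(\<Sum>k<m. c k * (v \<bullet> x k)\<^sup>2) = 0" by (intro sum.neutral) auto
  then show "X \<in> hyperplane_face v" using XK by (simp add: hyperplane_face_def e(1) inner_sum_right inner_outer_outer)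
qed

lemma maximal_face_eq_hyperplane_face:
  assumes F: "maximal_face completely_positive F" and v: "v \<noteq> 0" "\<And>x. x \<in> face_generators F \<Longrightarrow> v \<bullet> x = 0"
  shows "F = hyperplane_face v"
  using assms face_subset_hyperplane_face[of F v] hyperplane_face_proper[OF v(1)] unfolding maximal_face_def by blast

text \<open>Otherwise some nonzero \<open>a\<close> is orthogonal to \<open>v\<close> and to all
  these vectors. Testing on unit vectors and on two-term vectors shows that \<open>a\<close> is a
  multiple of \<open>v\<close>, a contradiction.\<close>

lemma dim_face_generators_hyperplane:
  fixes v :: "real ^ 'n::finite"
  assumes v: "(\<exists>i. v $ i > 0) \<and> (\<exists>i. v $ i < 0) \<or> (\<exists>i. v = axis i 1)"
  shows "CARD('n) \<le> dim {x :: real ^ 'n. (\<forall>i. 0 \<le> x $ i) \<and> v \<bullet> x = 0} + 1"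
proof (rule ccontr)
  let ?U = "{x :: real ^ 'n. (\<forall>i. 0 \<le> x $ i) \<and> v \<bullet> x = 0}"
  assume "\<not> ?thesis"
  then have "dim (insert v ?U) < DIM(real ^ 'n)" using dim_insert[of v ?U] by (simp split: if_splits)
  then obtain a where a: "a \<noteq> 0" "span (insert v ?U) \<subseteq> {x. a \<bullet> x = 0}"
    using lowdim_subset_hyperplane by blast
  then have av: "a \<bullet> v = 0" and aU: "\<And>x. x \<in> ?U \<Longrightarrow> a \<bullet> x = 0"
    using span_superset[of "insert v ?U"] by blast+
  have ax: "a $ j = 0" if "v $ j = 0" for j
    using aU[of "axis j 1"] that by (auto simp: inner_axis) (simp add: axis_def)
  show False
  proof (cases "\<exists>i. v = axis i 1")
    case True
    then obtain i where i: "v = axis i 1" by blast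
    then have "a $ i = 0" using av by (simp add: inner_axis)
    moreover have "a $ j = 0" if "j \<noteq> i" for j using ax[of j] that i by (simp add: axis_def)
    ultimately have "a = 0" by (metis vec_eq_iff zero_index)
    then show False using a by simp
  next
    case False
    then obtain p0 n0 where pn: "v $ p0 > 0" "v $ n0 < 0" using v by blast
    have cross: "a $ p * v $ n = a $ n * v $ p" if "v $ p > 0" "v $ n < 0" for p n
    proof -
      \<comment> \<open>The nonnegative vector orthogonal to \<open>v\<close> supported on one
        positive and one negative position of \<open>v\<close>.\<close>
      let ?x = "(- v $ n) *\<^sub>R axis p 1 + (v $ p) *\<^sub>R axis n (1::real)"
      have "v \<bullet> ?x = 0" by (simp add: inner_diff_right inner_add_right inner_axis)
      moreover have "0 \<le> ?x $ i" for i using that by (simp add: axis_def)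
      ultimately have "?x \<in> ?U" by blast
      from aU[OF this] show ?thesis by (simp add: inner_add_right inner_diff_right inner_axis mult.commute)
    qed
    define l where "l = a $ p0 / v $ p0"
    have ln: "a $ n = l * v $ n" if "v $ n < 0" for n
      using cross[OF pn(1) that] pn by (simp add: l_def field_simps)
    have lp: "a $ p = l * v $ p" if "v $ p > 0" for p
      using cross[OF that pn(2)] ln[OF pn(2)] pn(2) by simp
    have "a = l *\<^sub>R v"
      unfolding vec_eq_iff using ln lp ax by (metis linorder_neqE_linordered_idom mult_zero_right real_scaleR_def vector_scaleR_component)
    then have "a \<bullet> a = 0" using av by (simp add: inner_commute)
    then show False using a by simp
  qed
qed

lemma maximal_face_dim_lower:
  fixes F :: "(real ^ 'n::finite ^ 'n) set"
  assumes F: "maximal_face completely_positive F" and n: "CARD('n) \<ge> 3"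
  shows "int CARD('n) \<le> aff_dim F"
proof -
  have face: "F face_of completely_positive" "F \<noteq> {}" using F by (auto simp: maximal_face_def)
  have "0 \<in> F" using face_of_cone_zero[OF convex_cone_completely_positive face] .
  then have ad: "aff_dim F = int (dim F)" by (intro aff_dim_zero hull_inc)
  obtain B where B: "B \<subseteq> face_generators F" "independent B" "card B = dim (face_generators F)"
    using basis_exists by metis
  have BF: "outer ` B \<subseteq> F" using B(1) by (auto simp: face_generators_def)
  have two: "\<exists>b1 b2. b1 \<in> B \<and> b2 \<in> B \<and> b1 \<noteq> b2" if "card B \<ge> 2"
    using that by (metis card_le_Suc0_iff_eq card.infinite not_numeral_le_zero not_less_eq_eq numeral_2_eq_2)
  have "CARD('n) \<le> dim F"
  proof (cases "dim (face_generators F) \<ge> CARD('n)")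
    case True
    then have "card B \<ge> 2" using B(3) n by simp
    then obtain b1 b2 where "b1 \<in> B" "b2 \<in> B" "b1 \<noteq> b2" using two by blast
    from card_le_dim_outer(1)[OF B(2) BF this] show ?thesis using True B(3) by simp
  next
    case False
    then have "dim (face_generators F) < DIM(real ^ 'n)" by simp
    then obtain v where v: "v \<noteq> 0" "\<And>x. x \<in> face_generators F \<Longrightarrow> v \<bullet> x = 0"
      using lowdim_subset_hyperplane[of "face_generators F"] span_superset[of "face_generators F"] by blast
    note Fv = maximal_face_eq_hyperplane_face[OF F v]
    have "\<exists>v. F = hyperplane_face v \<and> ((\<exists>i. v $ i > 0) \<and> (\<exists>i. v $ i < 0) \<or> (\<exists>i. v = axis i 1))"
    proof (cases "(\<exists>i. v $ i > 0) \<and> (\<exists>i. v $ i < 0)")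
      case True
      then show ?thesis using Fv by blast
    next
      case False
      \<comment> \<open>For constant sign every summand of v . x vanishes, so all generators are
        zero at a position \<open>i\<close> with v_i nonzero, and \<open>v\<close> can be replaced
        by a unit vector.\<close>
      then have sg: "(\<forall>i. 0 \<le> v $ i) \<or> (\<forall>i. v $ i \<le> 0)" by (meson not_le)
      obtain i where i: "v $ i \<noteq> 0" using v(1) by (auto simp: vec_eq_iff)
      have "axis i 1 \<bullet> x = 0" if x: "x \<in> face_generators F" for x
      proof -
        have "(\<Sum>j\<in>UNIV. v $ j * x $ j) = 0" using v(2)[OF x] by (simp add: inner_vec_def)
        then have s0: "(\<Sum>j\<in>UNIV. - (v $ j * x $ j)) = 0" by (simp add: sum_negf)
        have xn: "0 \<le> x $ j" for j using x by (simp add: face_generators_def)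
        from sg have "v $ i * x $ i = 0"
        proof
          assume "\<forall>i. 0 \<le> v $ i"
          then show ?thesis
            using sum_nonneg_eq_0_iff[of UNIV "\<lambda>j. v $ j * x $ j"] xn \<open>(\<Sum>j\<in>UNIV. v $ j * x $ j) = 0\<close>
            by (simp del: mult_eq_0_iff)
        next
          assume "\<forall>i. v $ i \<le> 0"
          then have "0 \<le> - (v $ j * x $ j)" for j using xn[of j] by (simp add: mult_nonpos_nonneg)
          then show ?thesis
            using sum_nonneg_eq_0_iff[of UNIV "\<lambda>j. - (v $ j * x $ j)"] s0 by (simp del: mult_eq_0_iff)
        qed
        then show ?thesis using i by (simp add: inner_axis')
      qed
      moreover have "axis i (1::real) \<noteq> 0" by (simp add: axis_eq_0_iff)
      ultimately have "F = hyperplane_face (axis i 1)" by (intro maximal_face_eq_hyperplane_face[OF F]) auto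
      then show ?thesis by blast
    qed
    then obtain w where w: "F = hyperplane_face w" "(\<exists>i. w $ i > 0) \<and> (\<exists>i. w $ i < 0) \<or> (\<exists>i. w = axis i 1)" by blast
    have cB: "CARD('n) \<le> card B + 1"
      using dim_face_generators_hyperplane[OF w(2)] B(3) by (simp add: w(1) face_generators_hyperplane_face)
    then have "card B \<ge> 2" using n by simp
    then obtain b1 b2 where b: "b1 \<in> B" "b2 \<in> B" "b1 \<noteq> b2" using two by blast
    then have "b1 \<in> face_generators F" "b2 \<in> face_generators F" using B(1) by auto
    \<comment> \<open>The generators now form a cone in a hyperplane, so the sum is a generator and
      supplies the missing dimension.\<close>
    then have "b1 + b2 \<in> face_generators F" by (auto simp: w(1) face_generators_hyperplane_face inner_add_right)
    then have "outer (b1 + b2) \<in> F" by (simp add: face_generators_def)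
    from card_le_dim_outer(2)[OF B(2) BF b this] cB show ?thesis by simp
  qed
  then show ?thesis by (simp add: ad)
qed

section \<open>The upper bound\<close>

lemma bilinear_matrix:
  fixes \<beta> :: "real ^ 'n::finite \<Rightarrow> real ^ 'n \<Rightarrow> real"
  assumes "bilinear \<beta>"
  shows "(\<chi> i j. \<beta> (axis i 1) (axis j 1)) \<bullet> outer x = \<beta> x x"
proof -
  have e: "y = (\<Sum>j\<in>UNIV. y $ j *\<^sub>R axis j 1)" for y :: "real ^ 'n"
    using basis_expansion[of y] by (simp add: scalar_mult_eq_scaleR)
  have right: "\<beta> y x = (\<Sum>j\<in>UNIV. x $ j * \<beta> y (axis j 1))" for y
    by (subst e[of x]) (use assms in \<open>simp add: bilinear_def linear_sum linear_cmul\<close>)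
  have left: "\<beta> x y = (\<Sum>i\<in>UNIV. x $ i * \<beta> (axis i 1) y)" for y
  proof -
    have "linear (\<lambda>x. \<beta> x y)" using assms by (simp add: bilinear_def)
    from linear_sum[OF this, of "\<lambda>j. x $ j *\<^sub>R axis j 1" UNIV] linear_cmul[OF this]
    show ?thesis by (simp add: e[of x, symmetric])
  qed
  have "\<beta> x x = (\<Sum>i\<in>UNIV. x $ i * (\<Sum>j\<in>UNIV. x $ j * \<beta> (axis i 1) (axis j 1)))"
    unfolding left[of x] right[symmetric] ..
  then show ?thesis
    by (simp add: inner_vec_def outer_nth sum_distrib_left mult.assoc mult.commute mult.left_commute)
qed

lemma outer_scale: "outer (r *\<^sub>R x) = r\<^sup>2 *\<^sub>R outer x"
  by (simp add: vec_eq_iff outer_nth power2_eq_square)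

text \<open>Hence the outer products of all combinations of x and y lie in the span of three fixed
  matrices.\<close>

lemma outer_scale_add:
  "outer (s *\<^sub>R x + r *\<^sub>R y) =
    s\<^sup>2 *\<^sub>R outer x + r\<^sup>2 *\<^sub>R outer y + (s * r) *\<^sub>R (outer (x + y) - outer x - outer y)"
  by (simp add: vec_eq_iff outer_nth power2_eq_square algebra_simps)

context base_form
begin

definition form_matrix :: "real ^ 'a ^ 'a" where
  "form_matrix = (\<chi> i j. g (axis i 1) (axis j 1))"

lemma form_matrix_outer: "form_matrix \<bullet> outer x = g x x"
  unfolding form_matrix_def by (rule bilinear_matrix[OF bilinear_g])

lemma form_matrix_nonneg:
  assumes "X \<in> completely_positive" shows "0 \<le> form_matrix \<bullet> X"
proof -
  obtain n :: nat and d x where X: "X = (\<Sum>k<n. d k *\<^sub>R outer (x k))"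
    "\<forall>k<n. 0 \<le> d k" "\<forall>k<n. \<forall>i. 0 \<le> x k $ i"
    using completely_positive_sum[OF assms] by blast
  show ?thesis unfolding X(1) inner_sum_right
    by (intro sum_nonneg) (use X(2,3) g_nonneg in \<open>simp add: form_matrix_outer\<close>)
qed

definition form_face :: "(real ^ 'a ^ 'a) set" where
  "form_face = completely_positive \<inter> {X. form_matrix \<bullet> X = 0}"

lemma maximal_form_face: "maximal_face completely_positive form_face"
  unfolding form_face_def
proof (rule maximal_face_criterion[OF convex_cone_completely_positive form_matrix_nonneg])
  \<comment> \<open>A matrix off the face: \<open>u 0\<close> is a zero of \<open>g\<close>, and its
    pairing with the unit vector at position 0 is c > 0.\<close>
  let ?e = "axis (p 0) 1 :: real ^ 'a"
  have gu: "g (u 0) (u 0) = 0" using b_shift_U_null[of 0] by (simp add: g_def merge_last_u)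
  have "g (u 0) ?e = c"
  proof -
    have "\<not> m dvd 1" using m5 by simp
    then have "(-1) mod m \<noteq> 0" by (metis dvd_minus_iff mod_0_imp_dvd)
    then show ?thesis by (simp add: g_u axis_p_z axis_p)
  qed
  moreover have "g ?e (u 0) = g (u 0) ?e" by (simp add: g_def circ_form_commute)
  moreover have "0 \<le> g ?e ?e" by (rule g_nonneg) (simp add: axis_def)
  ultimately have "0 < g (u 0 + ?e) (u 0 + ?e)"
    using c_pos by (simp add: bilinear_ladd[OF bilinear_g] bilinear_radd[OF bilinear_g] gu)
  then show "form_matrix \<bullet> outer (u 0 + ?e) \<noteq> 0" by (simp add: form_matrix_outer)
  show "outer (u 0 + ?e) \<in> completely_positive"
    by (rule outer_completely_positive) (simp add: u_nonneg axis_def)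
next
  fix B :: "real ^ 'a ^ 'a"
  assume B: "\<And>X. X \<in> completely_positive \<Longrightarrow> 0 \<le> B \<bullet> X"
    "\<And>X. X \<in> completely_positive \<Longrightarrow> form_matrix \<bullet> X = 0 \<Longrightarrow> B \<bullet> X = 0"
  \<comment> \<open>Matrices here need not be symmetric, so the form of \<open>B\<close> is
    symmetrised; its diagonal is unchanged.\<close>
  define \<beta> where "\<beta> x y = (x \<bullet> (B *v y) + y \<bullet> (B *v x)) / 2" for x y :: "real ^ 'a"
  have diag: "\<beta> x x = B \<bullet> outer x" for x by (simp add: \<beta>_def inner_outer)
  have "\<exists>l. \<forall>x. \<beta> x x = l * g x x"
  proof (rule proportional[of \<beta>])
    show "bilinear \<beta>"
      unfolding bilinear_def
      by (intro conjI allI linearI)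
        (simp_all add: \<beta>_def algebra_simps inner_add_left inner_add_right matrix_vector_right_distrib
          matrix_vector_mult_scaleR add_divide_distrib)
    show "\<beta> x y = \<beta> y x" for x y by (simp add: \<beta>_def)
    show "0 \<le> \<beta> x x" if "\<And>j. 0 \<le> x $ j" for x
      unfolding diag by (intro B(1) outer_completely_positive allI that)
    show "\<beta> x x = 0" if "\<And>j. 0 \<le> x $ j" "g x x = 0" for x
      unfolding diag by (intro B(2) outer_completely_positive allI that) (simp add: form_matrix_outer that)
  qed
  then obtain l where l: "\<And>x. B \<bullet> outer x = l * (form_matrix \<bullet> outer x)" by (auto simp: diag form_matrix_outer)
  have "B \<bullet> X = l * (form_matrix \<bullet> X)" if X: "X \<in> completely_positive" for X
  proof -
    obtain n :: nat and d x where "X = (\<Sum>k<n. d k *\<^sub>R outer (x k))"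
      using completely_positive_sum[OF X] by blast
    then show ?thesis by (simp add: inner_sum_right l sum_distrib_left mult.left_commute)
  qed
  then show "\<exists>l. \<forall>X\<in>completely_positive. B \<bullet> X = l * (form_matrix \<bullet> X)" by blast
qed

text \<open>The m matrices of the \<open>u k\<close>, the matrix of \<open>q\<close> and three mixed
  ones for k = 1, 2, 3 span the face, because all its generators are classified by
  \<open>g_zeros\<close>.\<close>

lemma aff_dim_form_face: "aff_dim form_face \<le> m + 4"
proof -
  let ?T = "outer ` u ` {0..<m} \<union> {outer q} \<union> (\<lambda>k. outer (u k + q)) ` {1..3}"
  have face: "form_face face_of completely_positive" "form_face \<noteq> {}"
    using maximal_form_face by (auto simp: maximal_face_def)
  have zero: "outer x \<in> span ?T" if x: "x \<in> face_generators form_face" for x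
  proof -
    have "\<And>j. 0 \<le> x $ j" "g x x = 0"
      using x by (auto simp: face_generators_def form_face_def form_matrix_outer)
    from g_zeros[OF this] show ?thesis
    proof
      assume "\<exists>k\<in>{0..<m}. \<exists>s\<ge>0. x = s *\<^sub>R u k"
      then obtain k s where k: "k \<in> {0..<m}" "x = s *\<^sub>R u k" by blast
      then have "outer (u k) \<in> ?T" by blast
      then show ?thesis unfolding k(2) outer_scale by (intro span_mul span_base)
    next
      assume "\<exists>k\<in>{1..3}. \<exists>s r. x = s *\<^sub>R u k + r *\<^sub>R q"
      then obtain k s r where k: "k \<in> {1..3}" "x = s *\<^sub>R u k + r *\<^sub>R q" by blast
      then have "outer (u k) \<in> ?T" "outer q \<in> ?T" "outer (u k + q) \<in> ?T" using m5 by auto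
      then show ?thesis unfolding k(2) outer_scale_add
        by (intro span_add span_mul span_diff span_base)
    qed
  qed
  have "form_face \<subseteq> span ?T"
  proof
    fix X assume X: "X \<in> form_face"
    then obtain n :: nat and d x where e: "X = (\<Sum>k<n. d k *\<^sub>R outer (x k))"
      "\<forall>k<n. 0 \<le> d k" "\<forall>k<n. \<forall>i. 0 \<le> x k $ i"
      using completely_positive_sum unfolding form_face_def by blast
    have "d k *\<^sub>R outer (x k) \<in> span ?T" if "k < n" for k
    proof (cases "d k = 0")
      case False
      have "x k \<in> face_generators form_face"
        by (rule face_terms[OF face(1) X[unfolded e(1)] _ _ that False]) (use e in auto)
      then show ?thesis using zero by (intro span_mul)
    qed (simp add: span_zero)
    then show "X \<in> span ?T" unfolding e(1) by (intro span_sum) auto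
  qed
  then have "dim form_face \<le> card ?T" by (rule dim_le_card) simp
  also have "\<dots> \<le> card (outer ` u ` {0..<m}) + card {outer q} + card ((\<lambda>k. outer (u k + q)) ` {1..3::int})"
    by (meson card_Un_le add_right_mono order_trans)
  also have "\<dots> \<le> nat m + 1 + 3"
  proof -
    have "card (outer ` u ` {0..<m}) \<le> card {0..<m}"
      using card_image_le[of "{0..<m}" "\<lambda>k. outer (u k)"] by (simp add: image_image)
    moreover have "card ((\<lambda>k. outer (u k + q)) ` {1..3::int}) \<le> card {1..3::int}" by (rule card_image_le) simp
    ultimately show ?thesis by simp
  qed
  finally have "int (dim form_face) \<le> m + 4" using m_pos by linarith
  moreover have "aff_dim form_face = int (dim form_face)"
    using face_of_cone_zero[OF convex_cone_completely_positive face] by (intro aff_dim_zero hull_inc)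
  ultimately show ?thesis by simp
qed

end

lemma cyclic_enumeration_exists:
  assumes "even CARD('n::finite)" "CARD('n) \<ge> 6"
  obtains p :: "int \<Rightarrow> 'n::finite" and z where "cyclic_enumeration p z (int CARD('n) - 1)"
proof -
  \<comment> \<open>Any coordinate can serve as the last one; the others are enumerated modulo n -
    1.\<close>
  fix z :: 'n
  let ?m = "int CARD('n) - 1"
  have "card (UNIV - {z}) = CARD('n) - 1" by (simp add: card_Diff_singleton)
  then obtain h where h: "bij_betw h {0..<CARD('n) - 1} (UNIV - {z})"
    using ex_bij_betw_nat_finite[of "UNIV - {z}"] by auto
  define p where "p i = h (nat (i mod ?m))" for i
  have m: "?m > 0" using assms by simp
  have r: "nat (i mod ?m) \<in> {0..<CARD('n) - 1}" for i
  proof -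
    have "0 \<le> i mod ?m" "i mod ?m < ?m" using m by auto
    then show ?thesis by auto
  qed
  have "cyclic_enumeration p z ?m"
  proof
    show "p i = p j \<longleftrightarrow> i mod ?m = j mod ?m" for i j
    proof
      assume "p i = p j"
      then have "nat (i mod ?m) = nat (j mod ?m)"
        using h r by (auto simp: p_def bij_betw_def dest!: inj_onD)
      then show "i mod ?m = j mod ?m" using m by (simp add: eq_nat_nat_iff)
    qed (simp add: p_def)
    have "UNIV - {z} \<subseteq> range p"
    proof
      fix j assume "j \<in> UNIV - {z}"
      then obtain k where k: "k \<in> {0..<CARD('n) - 1}" "j = h k" using h unfolding bij_betw_def by (metis imageE)
      then have "int k mod ?m = int k" by (intro mod_pos_pos_trivial) auto
      then have "j = p (int k)" by (simp add: p_def k)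
      then show "j \<in> range p" by blast
    qed
    moreover have "p i \<in> UNIV - {z}" for i using h r[of i] by (auto simp: p_def bij_betw_def)
    ultimately show "range p = UNIV - {z}" by blast
  qed (use assms in auto)
  then show ?thesis by (rule that)
qed

theorem theorem4:
  assumes "even CARD('n::finite)" and "CARD('n) \<ge> 6"
  shows "int CARD('n) \<le> low TYPE('n) \<and> low TYPE('n) \<le> int CARD('n) + 3"
proof -
  let ?S = "{aff_dim F |F. maximal_face (completely_positive :: (real ^ 'n ^ 'n) set) F}"
  have fin: "finite ?S" by (rule finite_aff_dims)
  obtain p :: "int \<Rightarrow> 'n" and z where "cyclic_enumeration p z (int CARD('n) - 1)"
    using cyclic_enumeration_exists[OF assms] by blast
  then interpret cyclic_enumeration p z "int CARD('n) - 1" .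
  obtain U t e c where "base_form p z (int CARD('n) - 1) U t e c" using base_form_exists by blast
  then interpret base_form p z "int CARD('n) - 1" U t e c .
  have mem: "aff_dim form_face \<in> ?S" using maximal_form_face by blast
  have "low TYPE('n) \<le> aff_dim form_face" unfolding low_def by (rule Min_le[OF fin mem])
  also have "\<dots> \<le> int CARD('n) + 3" using aff_dim_form_face by simp
  finally have "low TYPE('n) \<le> int CARD('n) + 3" .
  moreover have "int CARD('n) \<le> low TYPE('n)"
  proof -
    \<comment> \<open>The form face makes this finite set nonempty, so the minimum is attained by
      some maximal face.\<close>
    have "low TYPE('n) \<in> ?S" unfolding low_def using fin mem by (intro Min_in) auto
    then obtain F where F: "low TYPE('n) = aff_dim F"
      "maximal_face (completely_positive :: (real ^ 'n ^ 'n) set) F" by blast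
    show ?thesis unfolding F(1) by (rule maximal_face_dim_lower[OF F(2)]) (use assms in simp)
  qed
  ultimately show ?thesis by simp
qed

end
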